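(* Let $F\subset\mathbb{T}=\{z\in\mathbb{C}:|z|=1\}=\partial\mathbb{D}$ be a closed subset of zero Haar measure, e.g., some fixed Cantor subset of $\mathbb{T}$. Set $\mathscr{D}_F:=\{f\in\mathscr{D}(H) : f=0\text{ on }F\}$. Then the restriction $L_F$ of $H=z\frac{d}{dz}$ to $\mathscr{D}_F$ is Hermitian with dense domain in the Hardy space $\mathscr{H}_2$, and with deficiency indices $(\infty,\infty)$.
   Context: $\mathbb{D}=\{z\in\mathbb{C}:|z|<1\}$, $\mathbb{N}_0=\{0,1,2,\ldots\}$. $\mathscr{H}_2$ is the Hardy space of analytic functions $f(z)=\sum_{k\in\mathbb{N}_0}x_kz^k$ on $\mathbb{D}$ with $\|f\|^2=\sum|x_k|^2<\infty$. $H=z\frac{d}{dz}$ is the selfadjoint operator in $\mathscr{H}_2$ with domain $\mathscr{D}(H)=\{f\in\mathscr{H}_2: z\frac{d}{dz}f\in\mathscr{H}_2\}$, i.e. $\sum k^2|x_k|^2<\infty$. For $f\in\mathscr{D}(H)$ the Taylor coefficients are absolutely summable, so $f$ has a continuous extension to $\overline{\mathbb{D}}$, and "$f=0$ on $F$" refers to this extension. "Hermitian" means $\langle f,Lg\rangle=\langle Lf,g\rangle$ for all $f,g$ in the domain of the operator $L$. The deficiency indices of a densely defined Hermitian operator $L$ are $(\dim\ker(L^*-iI),\dim\ker(L^*+iI))$.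
   Formalization: F is additionally assumed infinite (finite F gives indices (|F|,|F|)) and to satisfy Carleson's condition, log dist(·,F) integrable on T (otherwise D_F={0} and the domain is not dense); both conditions are necessary for the claim. *)

theory Defs
  imports "HOL-Complex_Analysis.Complex_Analysis" "HOL-Library.Function_Algebras"
    "HOL-Library.Extended_Nat"
begin

section \<open>The Hardy space of the unit disc\<close>

type_synonym cfun = "complex \<Rightarrow> complex"

definition taylor_coeff :: "cfun \<Rightarrow> nat \<Rightarrow> complex" where
  "taylor_coeff f k = (deriv ^^ k) f 0 / of_nat (fact k)"

text \<open>A function on the open disc is represented by its extension by 0 to the whole plane, so that
  equality of elements is equality of functions on the disc and the vector space operations
  are the pointwise ones. The values off the disc carry no meaning; in particular they are not
  boundary values.\<close>

definition hardy2 :: "cfun set" where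
  "hardy2 = {f. f holomorphic_on ball 0 1 \<and> (\<forall>z. z \<notin> ball 0 1 \<longrightarrow> f z = 0) \<and>
                summable (\<lambda>k. (cmod (taylor_coeff f k))\<^sup>2)}"

text \<open>The inner product is linear in the second argument.\<close>

definition hinner :: "cfun \<Rightarrow> cfun \<Rightarrow> complex" where
  "hinner f g = (\<Sum>k. cnj (taylor_coeff f k) * taylor_coeff g k)"

definition hnorm :: "cfun \<Rightarrow> real" where
  "hnorm f = sqrt (\<Sum>k. (cmod (taylor_coeff f k))\<^sup>2)"

definition cscale :: "complex \<Rightarrow> cfun \<Rightarrow> cfun" where
  "cscale c f = (\<lambda>z. c * f z)"

lemma vector_space_cscale: "vector_space cscale"
  by unfold_locales (auto simp: cscale_def fun_eq_iff algebra_simps)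

text \<open>Complex dimension of a subspace, with all infinite dimensions identified.\<close>

definition cdim :: "cfun set \<Rightarrow> enat" where
  "cdim V = (if \<exists>B. finite B \<and> V \<subseteq> module.span cscale B
             then enat (vector_space.dim cscale V) else \<infinity>)"


section \<open>Unbounded operators in the Hardy space\<close>

text \<open>An operator is a pair of its domain and its action; the action is only meaningful on the
  domain.\<close>

type_synonym hop = "cfun set \<times> (cfun \<Rightarrow> cfun)"

abbreviation dom_op :: "hop \<Rightarrow> cfun set" where "dom_op \<equiv> fst"
abbreviation app_op :: "hop \<Rightarrow> cfun \<Rightarrow> cfun" where "app_op \<equiv> snd"

definition restrict_op :: "hop \<Rightarrow> cfun set \<Rightarrow> hop" where
  "restrict_op L D = (dom_op L \<inter> D, app_op L)"

definition hermitian_op :: "hop \<Rightarrow> bool" where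
  "hermitian_op L \<longleftrightarrow>
     (\<forall>f\<in>dom_op L. \<forall>g\<in>dom_op L. hinner f (app_op L g) = hinner (app_op L f) g)"

definition densely_defined :: "hop \<Rightarrow> bool" where
  "densely_defined L \<longleftrightarrow>
     dom_op L \<subseteq> hardy2 \<and> (\<forall>f\<in>hardy2. \<forall>e>0. \<exists>g\<in>dom_op L. hnorm (f - g) < e)"

text \<open>For densely defined \<open>L\<close> the vector \<open>h\<close> below is unique.\<close>

definition adjoint_op :: "hop \<Rightarrow> hop" where
  "adjoint_op L =
     ({g\<in>hardy2. \<exists>h\<in>hardy2. \<forall>f\<in>dom_op L. hinner g (app_op L f) = hinner h f},
      \<lambda>g. THE h. h \<in> hardy2 \<and> (\<forall>f\<in>dom_op L. hinner g (app_op L f) = hinner h f))"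

definition eigenspace_op :: "hop \<Rightarrow> complex \<Rightarrow> cfun set" where
  "eigenspace_op L c = {g\<in>dom_op L. app_op L g - cscale c g = 0}"

definition deficiency_indices :: "hop \<Rightarrow> enat \<times> enat" where
  "deficiency_indices L =
     (cdim (eigenspace_op (adjoint_op L) \<i>), cdim (eigenspace_op (adjoint_op L) (- \<i>)))"


section \<open>The operator \<open>z d/dz\<close> and its restrictions\<close>

definition zddz :: "cfun \<Rightarrow> cfun" where
  "zddz f = (\<lambda>z. if z \<in> ball 0 1 then z * deriv f z else 0)"

definition H_op :: hop where
  "H_op = ({f\<in>hardy2. zddz f \<in> hardy2}, zddz)"

text \<open>The continuous extension of \<open>f\<close> from the open to the closed disc is unique if it exists, and
  it exists for every \<open>f\<close> in the domain of \<open>H_op\<close>.\<close>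

definition vanishes_on :: "cfun \<Rightarrow> complex set \<Rightarrow> bool" where
  "vanishes_on f F \<longleftrightarrow>
     (\<exists>g. continuous_on (cball 0 1) g \<and> (\<forall>z\<in>ball 0 1. g z = f z) \<and> (\<forall>z\<in>F. g z = 0))"

definition L_op :: "complex set \<Rightarrow> hop" where
  "L_op F = restrict_op H_op {f\<in>dom_op H_op. vanishes_on f F}"


section \<open>Closed subsets of the unit circle\<close>

definition circle_haar :: "complex measure" where
  "circle_haar = distr (uniform_measure lborel {0..<2 * pi}) borel cis"

text \<open>Carleson's condition. Functions in the domain of \<open>H_op\<close> have boundary values that are Hoelder
  continuous of order 1/2, and \<open>log |f|\<close> is integrable on the circle for every nonzero
  \<open>f\<close> in the Hardy space. Hence a closed null set \<open>F\<close> without this property carries no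
  nonzero \<open>f\<close> in the domain of \<open>H_op\<close> with \<open>f = 0\<close> on \<open>F\<close>.
  Since \<open>ln 0 = 0\<close>, the condition does not by itself force \<open>F\<close> to be a null set.\<close>

definition carleson_condition :: "complex set \<Rightarrow> bool" where
  "carleson_condition F \<longleftrightarrow> integrable circle_haar (\<lambda>z. ln (infdist z F))"

end

theory Submission imports Defs begin

text \<open>
  On Taylor coefficients \<open>z d/dz\<close> is multiplication by \<open>k\<close>, which makes every restriction of it
  Hermitian. The other two claims concern evaluation at the points of \<open>F\<close>.

  For \<open>w \<in> F\<close>, the function \<open>g\<close> with coefficients \<open>cnj w ^ k / (k - c)\<close> satisfies
  \<open>\<langle>g, H f\<rangle> - \<langle>c g, f\<rangle> = f w\<close> for every \<open>f\<close> in the domain of \<open>H\<close>. If \<open>f\<close> vanishes on \<open>F\<close> the right-hand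
  side is zero, so \<open>g\<close> is an eigenvector of the adjoint for the eigenvalue \<open>c = \<i>\<close> or \<open>c = - \<i>\<close>
  (\<open>deficiency_vector_eigen\<close>). Geometric sequences with distinct ratios are linearly independent,
  so an infinite set \<open>F\<close> produces an infinite-dimensional eigenspace (\<open>cdim_deficiency\<close>). Density of
  the domain enters here as well, because it makes the value of the adjoint at \<open>g\<close> unique.

  Density is the substantial part. The domain is stable under multiplication by polynomials and
  polynomials are dense, so it suffices to approximate the constant \<open>1\<close> by functions \<open>u\<close> of the
  domain. When \<open>\<bar>u\<bar> \<le> 1\<close>, the norm of \<open>1 - u\<close> is controlled by the single number \<open>u 0\<close>, since
  \<open>\<parallel>1 - u\<parallel>\<^sup>2 = 1 - 2 Re (u 0) + \<parallel>u\<parallel>\<^sup>2\<close> (\<open>hnorm_one_diff_square_le\<close>). So one needs functions bounded by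
  \<open>1\<close> that vanish on \<open>F\<close>, have a bounded derivative, and are nearly \<open>1\<close> at the origin. These are
  \<open>exp (- 18 g)\<close>, where \<open>g\<close> has positive real part and blows up at least logarithmically at \<open>F\<close>
  (\<open>exists_vanishing_function\<close>): \<open>g\<close> is a sum of simple poles placed behind the points of a
  \<open>2\<^sup>-\<^sup>n\<close>-net of \<open>F\<close>, with weight \<open>2\<^sup>-\<^sup>n\<close> each, over all large \<open>n\<close>. At the origin this sum converges exactly if
  \<open>2\<^sup>-\<^sup>n\<close> times the cardinality of the nets is summable, and Carleson's condition
  provides this through the measures of the neighbourhoods of \<open>F\<close> (\<open>separated_net\<close>, \<open>carleson_summable\<close>).
  Starting the sum at a large \<open>n\<close> makes \<open>g 0\<close> small without changing the order of growth at \<open>F\<close>.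
\<close>

section \<open>Taylor coefficients and Parseval\<close>

lemma has_fps_expansion_taylor:
  assumes "f holomorphic_on ball 0 1"
  shows "f has_fps_expansion Abs_fps (taylor_coeff f)"
proof -
  have "f has_fps_expansion fps_expansion f 0"
    using assms by (intro has_fps_expansion_fps_expansion[of "ball 0 1"]) auto
  also have "fps_expansion f 0 = Abs_fps (taylor_coeff f)"
    unfolding fps_expansion_def taylor_coeff_def of_nat_fact by (rule refl)
  finally show ?thesis .
qed

lemma taylor_coeff_fps:
  assumes "f has_fps_expansion A"
  shows "taylor_coeff f k = fps_nth A k"
  using fps_nth_fps_expansion[OF assms] by (simp add: taylor_coeff_def)

lemma taylor_coeff_sums:
  assumes "f holomorphic_on ball 0 1" and "z \<in> ball 0 1"
  shows "(\<lambda>k. taylor_coeff f k * z ^ k) sums f z"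
  using holomorphic_power_series[OF assms] by (simp add: taylor_coeff_def)

lemma taylor_coeff_diff:
  assumes "f holomorphic_on ball 0 1" "g holomorphic_on ball 0 1"
  shows "taylor_coeff (f - g) k = taylor_coeff f k - taylor_coeff g k"
proof -
  have "(f - g) has_fps_expansion (Abs_fps (taylor_coeff f) - Abs_fps (taylor_coeff g))"
    unfolding fun_diff_def by (intro has_fps_expansion_diff has_fps_expansion_taylor assms)
  from taylor_coeff_fps[OF this] show ?thesis by simp
qed

lemma taylor_coeff_add:
  assumes "f holomorphic_on ball 0 1" "g holomorphic_on ball 0 1"
  shows "taylor_coeff (f + g) k = taylor_coeff f k + taylor_coeff g k"
proof -
  have "(f + g) has_fps_expansion (Abs_fps (taylor_coeff f) + Abs_fps (taylor_coeff g))"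
    unfolding plus_fun_def by (intro has_fps_expansion_add has_fps_expansion_taylor assms)
  from taylor_coeff_fps[OF this] show ?thesis by simp
qed

lemma taylor_coeff_cscale:
  assumes "f holomorphic_on ball 0 1"
  shows "taylor_coeff (cscale c f) k = c * taylor_coeff f k"
proof -
  have "(cscale c f) has_fps_expansion (fps_const c * Abs_fps (taylor_coeff f))"
    unfolding cscale_def by (intro has_fps_expansion_cmult_left has_fps_expansion_taylor assms)
  from taylor_coeff_fps[OF this] show ?thesis by simp
qed

lemma taylor_coeff_shift:
  assumes "f holomorphic_on ball 0 1"
  shows "taylor_coeff (\<lambda>z. z ^ m * f z) k = (if k < m then 0 else taylor_coeff f (k - m))"
proof -
  have "(\<lambda>z. z ^ m * f z) has_fps_expansion (fps_X ^ m * Abs_fps (taylor_coeff f))"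
    by (intro has_fps_expansion_mult has_fps_expansion_fps_X_power has_fps_expansion_taylor assms)
  from taylor_coeff_fps[OF this] show ?thesis by (simp add: fps_X_power_mult_nth)
qed

lemma eventually_nhds_unit_disc: "eventually (\<lambda>z::complex. z \<in> ball 0 1) (nhds 0)"
  by (rule eventually_nhds_in_open) auto

lemma taylor_coeff_zddz:
  assumes "f holomorphic_on ball 0 1"
  shows "taylor_coeff (zddz f) k = of_nat k * taylor_coeff f k"
proof -
  have "(\<lambda>z. z * deriv f z) has_fps_expansion (fps_X * fps_deriv (Abs_fps (taylor_coeff f)))"
    by (intro has_fps_expansion_mult has_fps_expansion_fps_X has_fps_expansion_deriv
        has_fps_expansion_taylor assms)
  also have "?this \<longleftrightarrow> zddz f has_fps_expansion (fps_X * fps_deriv (Abs_fps (taylor_coeff f)))"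
    by (intro has_fps_expansion_cong refl eventually_mono[OF eventually_nhds_unit_disc])
      (simp add: zddz_def)
  finally have "zddz f has_fps_expansion (fps_X * fps_deriv (Abs_fps (taylor_coeff f)))" .
  from taylor_coeff_fps[OF this] show ?thesis by (cases k) auto
qed

lemma zddz_holomorphic:
  assumes "f holomorphic_on ball 0 1"
  shows "zddz f holomorphic_on ball 0 1"
proof -
  have "(\<lambda>z. z * deriv f z) holomorphic_on ball 0 1"
    by (intro holomorphic_intros holomorphic_deriv assms) auto
  then show ?thesis
    by (rule holomorphic_transform) (simp add: zddz_def)
qed

definition disc_series :: "(nat \<Rightarrow> complex) \<Rightarrow> cfun" where
  "disc_series a z = (if z \<in> ball 0 1 then \<Sum>k. a k * z ^ k else 0)"

lemma
  fixes a :: "nat \<Rightarrow> complex"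
  assumes bd: "\<And>k. cmod (a k) \<le> B"
  shows disc_series_holomorphic: "disc_series a holomorphic_on ball 0 1"
    and taylor_coeff_disc_series: "taylor_coeff (disc_series a) k = a k"
proof -
  have rad: "fps_conv_radius (Abs_fps a) \<ge> 1"
    unfolding fps_conv_radius_def
  proof (rule conv_radius_geI_ex')
    fix r :: real assume r: "0 < r" "ereal r < 1"
    show "summable (\<lambda>n. fps_nth (Abs_fps a) n * of_real r ^ n)"
    proof (rule summable_comparison_test'[where N = 0])
      show "summable (\<lambda>n. B * r ^ n)"
        using r by (intro summable_mult summable_geometric) auto
      show "norm (fps_nth (Abs_fps a) n * complex_of_real r ^ n) \<le> B * r ^ n" for n
        using r bd[of n] by (auto simp: norm_mult norm_power intro!: mult_right_mono)
    qed
  qed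
  have sub: "ball (0::complex) 1 \<subseteq> eball 0 (fps_conv_radius (Abs_fps a))"
  proof
    fix z :: complex assume "z \<in> ball 0 1"
    then have "ereal (norm z) < 1" by simp
    also note rad
    finally show "z \<in> eball 0 (fps_conv_radius (Abs_fps a))" by (simp add: in_eball_iff)
  qed
  have "eval_fps (Abs_fps a) holomorphic_on ball 0 1"
    by (rule holomorphic_on_eval_fps[OF sub])
  then show "disc_series a holomorphic_on ball 0 1"
    by (rule holomorphic_transform) (simp add: disc_series_def eval_fps_def)
  have pos: "fps_conv_radius (Abs_fps a) > 0"
    by (rule less_le_trans[OF _ rad]) simp
  have "eval_fps (Abs_fps a) has_fps_expansion Abs_fps a"
    by (rule eval_fps_has_fps_expansion[OF pos])
  also have "?this \<longleftrightarrow> disc_series a has_fps_expansion Abs_fps a"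
    by (intro has_fps_expansion_cong refl eventually_mono[OF eventually_nhds_unit_disc])
      (simp add: disc_series_def eval_fps_def)
  finally show "taylor_coeff (disc_series a) k = a k"
    by (simp add: taylor_coeff_fps)
qed

text \<open>Parseval's identity for the discrete Fourier transform. Averaging over the \<open>N\<close>-th roots of
  unity in place of the whole circle makes Parseval for polynomials of degree below \<open>N\<close> a finite
  geometric sum.\<close>

lemma sum_square_roots_of_unity:
  fixes b :: "nat \<Rightarrow> complex"
  assumes N: "N > 0"
  defines "w \<equiv> cis (2 * pi / real N)"
  shows "(\<Sum>j<N. (cmod (\<Sum>k<N. b k * w ^ (j * k)))\<^sup>2) = real N * (\<Sum>k<N. (cmod (b k))\<^sup>2)"
proof -
  have orth: "(\<Sum>j<N. w ^ (j * k) * cnj (w ^ (j * l))) = (if k = l then of_nat N else 0)"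
    if kl: "k < N" "l < N" for k l
  proof -
    define x where "x = w ^ k * cnj (w ^ l)"
    have x: "x = cis (2 * pi * (real k - real l) / real N)"
      by (simp add: x_def w_def Complex.DeMoivre cis_cnj cis_mult algebra_simps diff_divide_distrib)
    have eq: "(\<Sum>j<N. w ^ (j * k) * cnj (w ^ (j * l))) = (\<Sum>j<N. x ^ j)"
      by (simp add: x_def power_mult_distrib power_mult [symmetric] mult.commute)
    have xN: "x ^ N = 1"
    proof -
      have "x ^ N = cis (2 * pi * of_int (int k - int l))"
        using N by (simp add: x Complex.DeMoivre)
      also have "\<dots> = 1" by (rule cis_multiple_2pi) auto
      finally show ?thesis .
    qed
    show ?thesis
    proof (cases "k = l")
      case True
      then have "x = 1" by (simp add: x)
      then show ?thesis using True eq by simp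
    next
      case False
      have "x \<noteq> 1"
      proof
        assume "x = 1"
        then have "cos (2 * pi * (real k - real l) / real N) = 1"
          unfolding x by (metis cis.sel(1) one_complex.sel(1))
        then obtain m :: int where m: "2 * pi * (real k - real l) / real N = of_int m * 2 * pi"
          using cos_one_2pi_int by auto
        then have "(2 * pi) * (real k - real l) = (2 * pi) * (of_int m * real N)"
          using N by (simp add: field_simps)
        then have "real k - real l = of_int m * real N"
          by (simp only: mult_cancel_left) simp
        then have "real_of_int (int k - int l) = of_int (m * int N)" by simp
        then have *: "int k - int l = m * int N" by (simp only: of_int_eq_iff)
        then have "\<bar>m * int N\<bar> < int N" using kl by auto
        then have "m = 0" using N by (simp add: abs_mult)
        then show False using * False by simp
      qed
      then have "(\<Sum>j<N. x ^ j) = 0" using xN by (simp add: sum_gp_strict)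
      then show ?thesis using eq False by simp
    qed
  qed
  have "complex_of_real (\<Sum>j<N. (cmod (\<Sum>k<N. b k * w ^ (j * k)))\<^sup>2)
      = (\<Sum>j<N. \<Sum>k<N. \<Sum>l<N. b k * cnj (b l) * (w ^ (j * k) * cnj (w ^ (j * l))))"
    by (simp only: of_real_sum complex_norm_square cnj_sum sum_product complex_cnj_mult ac_simps)
  also have "\<dots> = (\<Sum>k<N. \<Sum>j<N. \<Sum>l<N. b k * cnj (b l) * (w ^ (j * k) * cnj (w ^ (j * l))))"
    by (rule sum.swap)
  also have "\<dots> = (\<Sum>k<N. \<Sum>l<N. \<Sum>j<N. b k * cnj (b l) * (w ^ (j * k) * cnj (w ^ (j * l))))"
    by (intro sum.cong refl sum.swap)
  also have "\<dots> = (\<Sum>k<N. \<Sum>l<N. b k * cnj (b l) * (if k = l then of_nat N else 0))"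
    unfolding sum_distrib_left[symmetric] by (intro sum.cong refl arg_cong2[where f = "(*)"] orth) auto
  also have "\<dots> = (\<Sum>k<N. b k * cnj (b k) * of_nat N)"
    by (intro sum.cong refl) (simp add: if_distrib cong: if_cong)
  also have "\<dots> = complex_of_real (real N * (\<Sum>k<N. (cmod (b k))\<^sup>2))"
    by (simp only: complex_norm_square of_real_mult of_real_sum of_real_of_nat_eq
        sum_distrib_left ac_simps)
  finally show ?thesis by (simp only: of_real_eq_iff)
qed

text \<open>On a circle of radius \<open>r < 1\<close> the Taylor polynomials converge uniformly, hence they are bounded
  by \<open>B + e\<close> from some degree on; Parseval for the polynomial bounds its coefficients, and then
  \<open>e\<close> tends to \<open>0\<close> and \<open>r\<close> to \<open>1\<close>.\<close>

lemma bounded_holomorphic_sum_square: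
  assumes hol: "f holomorphic_on ball 0 1" and bd: "\<And>z. z \<in> ball 0 1 \<Longrightarrow> cmod (f z) \<le> B"
  shows "(\<Sum>k<K. (cmod (taylor_coeff f k))\<^sup>2) \<le> B\<^sup>2"
proof -
  have B0: "B \<ge> 0" using order_trans[OF norm_ge_zero bd[of 0]] by simp
  define a where "a = taylor_coeff f"
  have r_bound: "(\<Sum>k<K. (cmod (a k) * r ^ k)\<^sup>2) \<le> (B + e)\<^sup>2" if r: "0 < r" "r < 1" and e: "e > 0" for r e
  proof -
    have "summable (\<lambda>k. norm (a k * complex_of_real r ^ k))"
    proof (rule powser_insidea)
      show "summable (\<lambda>n. a n * complex_of_real ((1 + r) / 2) ^ n)"
      proof -
        have "complex_of_real ((1 + r) / 2) \<in> ball 0 1"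
          unfolding mem_ball dist_0_norm norm_of_real using r by simp
        from taylor_coeff_sums[OF hol this] show ?thesis by (simp only: a_def sums_iff)
      qed
      show "norm (complex_of_real r) < norm (complex_of_real ((1 + r) / 2))"
        unfolding norm_of_real using r by simp
    qed
    then have "summable (\<lambda>k. cmod (a k) * r ^ k)" using r by (simp add: norm_mult norm_power)
    then have "uniform_limit (sphere 0 r) (\<lambda>n z. \<Sum>k<n. a k * z ^ k) (\<lambda>z. \<Sum>k. a k * z ^ k) sequentially"
      by (intro Weierstrass_m_test) (auto simp: norm_mult norm_power)
    then have "eventually (\<lambda>n. \<forall>z\<in>sphere 0 r. dist (\<Sum>k<n. a k * z ^ k) (\<Sum>k. a k * z ^ k) < e) sequentially"
      using e by (rule uniform_limitD)
    then have "eventually (\<lambda>n. n \<ge> Suc K \<and> (\<forall>z\<in>sphere 0 r. dist (\<Sum>k<n. a k * z ^ k) (\<Sum>k. a k * z ^ k) < e)) sequentially"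
      by (intro eventually_conj eventually_ge_at_top)
    then obtain N where NK: "N \<ge> Suc K"
      and N: "\<And>z. z \<in> sphere 0 r \<Longrightarrow> dist (\<Sum>k<N. a k * z ^ k) (\<Sum>k. a k * z ^ k) < e"
      unfolding eventually_sequentially by blast
    have part: "cmod (\<Sum>k<N. a k * z ^ k) \<le> B + e" if z: "cmod z = r" for z
    proof -
      have zb: "z \<in> ball 0 1" using z r by simp
      have "(\<Sum>k. a k * z ^ k) = f z"
        using taylor_coeff_sums[OF hol zb] by (simp add: a_def sums_iff)
      then have "dist (\<Sum>k<N. a k * z ^ k) (f z) < e" using N[of z] z by simp
      then show ?thesis using bd[OF zb] norm_triangle_ineq2[of "\<Sum>k<N. a k * z ^ k" "f z"]
        by (simp add: dist_norm)
    qed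
    define w where "w = cis (2 * pi / real N)"
    have Npos: "N > 0" using NK by simp
    \<comment> \<open>The mean square of the Taylor polynomial over the points \<open>r * w ^ j\<close>.\<close>
    have "real N * (\<Sum>k<N. (cmod (a k * of_real r ^ k))\<^sup>2)
        = (\<Sum>j<N. (cmod (\<Sum>k<N. a k * of_real r ^ k * w ^ (j * k)))\<^sup>2)"
      using sum_square_roots_of_unity[OF Npos, of "\<lambda>k. a k * of_real r ^ k"] by (simp add: w_def)
    also have "\<dots> = (\<Sum>j<N. (cmod (\<Sum>k<N. a k * (of_real r * w ^ j) ^ k))\<^sup>2)"
      by (simp add: power_mult_distrib power_mult[symmetric] mult.assoc)
    also have "\<dots> \<le> (\<Sum>j<N. (B + e)\<^sup>2)"
      using r by (intro sum_mono power_mono part) (auto simp: norm_mult norm_power w_def)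
    also have "\<dots> = real N * (B + e)\<^sup>2" by simp
    finally have "(\<Sum>k<N. (cmod (a k * of_real r ^ k))\<^sup>2) \<le> (B + e)\<^sup>2"
      using Npos by (simp add: mult_le_cancel_left)
    moreover have "(\<Sum>k<K. (cmod (a k * of_real r ^ k))\<^sup>2) \<le> (\<Sum>k<N. (cmod (a k * of_real r ^ k))\<^sup>2)"
      using NK by (intro sum_mono2) auto
    ultimately show ?thesis using r by (simp add: norm_mult norm_power)
  qed
  have r_bound': "(\<Sum>k<K. (cmod (a k) * r ^ k)\<^sup>2) \<le> B\<^sup>2" if r: "0 < r" "r < 1" for r
  proof -
    have "((\<lambda>e. (B + e)\<^sup>2) \<longlongrightarrow> (B + 0)\<^sup>2) (at_right 0)"
      by (intro tendsto_intros)
    moreover have "eventually (\<lambda>e. (\<Sum>k<K. (cmod (a k) * r ^ k)\<^sup>2) \<le> (B + e)\<^sup>2) (at_right 0)"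
      using r_bound[OF r] by (auto intro: eventually_at_rightI[of 0 1])
    ultimately have "(\<Sum>k<K. (cmod (a k) * r ^ k)\<^sup>2) \<le> (B + 0)\<^sup>2"
      by (rule tendsto_lowerbound) simp
    then show ?thesis by simp
  qed
  have "((\<lambda>r. \<Sum>k<K. (cmod (a k) * r ^ k)\<^sup>2) \<longlongrightarrow> (\<Sum>k<K. (cmod (a k) * 1 ^ k)\<^sup>2)) (at_left 1)"
    by (intro tendsto_intros)
  moreover have "eventually (\<lambda>r. (\<Sum>k<K. (cmod (a k) * r ^ k)\<^sup>2) \<le> B\<^sup>2) (at_left 1)"
    using r_bound' by (auto intro: eventually_at_leftI[of 0 1])
  ultimately have "(\<Sum>k<K. (cmod (a k) * 1 ^ k)\<^sup>2) \<le> B\<^sup>2"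
    by (rule tendsto_upperbound) simp
  then show ?thesis by (simp add: a_def)
qed

section \<open>The Hilbert space structure of the Hardy space\<close>

lemma hardy2I:
  assumes "f holomorphic_on ball 0 1" "\<And>z. z \<notin> ball 0 1 \<Longrightarrow> f z = 0"
    "summable (\<lambda>k. (cmod (taylor_coeff f k))\<^sup>2)"
  shows "f \<in> hardy2"
  using assms by (auto simp: hardy2_def)

lemma
  assumes "f \<in> hardy2"
  shows hardy2_holomorphic: "f holomorphic_on ball 0 1"
    and hardy2_outside: "z \<notin> ball 0 1 \<Longrightarrow> f z = 0"
    and hardy2_summable: "summable (\<lambda>k. (cmod (taylor_coeff f k))\<^sup>2)"
  using assms by (auto simp: hardy2_def)

lemma hnorm_nonneg: "f \<in> hardy2 \<Longrightarrow> hnorm f \<ge> 0"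
  unfolding hnorm_def by (intro real_sqrt_ge_zero suminf_nonneg hardy2_summable) auto

lemma hnorm_square:
  assumes "f \<in> hardy2"
  shows "(hnorm f)\<^sup>2 = (\<Sum>k. (cmod (taylor_coeff f k))\<^sup>2)"
  unfolding hnorm_def using assms
  by (intro real_sqrt_pow2 suminf_nonneg hardy2_summable) auto

lemma hardy2_cscale:
  assumes f: "f \<in> hardy2"
  shows "cscale c f \<in> hardy2"
proof (rule hardy2I)
  show "cscale c f holomorphic_on ball 0 1"
    unfolding cscale_def by (intro holomorphic_intros hardy2_holomorphic f)
  show "cscale c f z = 0" if "z \<notin> ball 0 1" for z
    using hardy2_outside[OF f that] by (simp add: cscale_def)
  show "summable (\<lambda>k. (cmod (taylor_coeff (cscale c f) k))\<^sup>2)"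
    using hardy2_summable[OF f]
    by (simp add: taylor_coeff_cscale hardy2_holomorphic[OF f] norm_mult power_mult_distrib summable_mult)
qed

lemma cmod_add_square_le: "(cmod (a + b))\<^sup>2 \<le> 2 * (cmod a)\<^sup>2 + 2 * (cmod b)\<^sup>2"
proof -
  have "(cmod (a + b))\<^sup>2 \<le> (cmod a + cmod b)\<^sup>2"
    by (intro power_mono norm_triangle_ineq) auto
  also have "\<dots> \<le> 2 * (cmod a)\<^sup>2 + 2 * (cmod b)\<^sup>2"
    using sum_squares_bound[of "cmod a" "cmod b"] by (simp add: power2_sum)
  finally show ?thesis .
qed

lemma hardy2_add:
  assumes f: "f \<in> hardy2" and g: "g \<in> hardy2"
  shows "f + g \<in> hardy2"
proof (rule hardy2I)
  show "(f + g) holomorphic_on ball 0 1"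
    unfolding plus_fun_def by (intro holomorphic_intros hardy2_holomorphic f g)
  show "(f + g) z = 0" if "z \<notin> ball 0 1" for z
    using hardy2_outside[OF f that] hardy2_outside[OF g that] by simp
  show "summable (\<lambda>k. (cmod (taylor_coeff (f + g) k))\<^sup>2)"
  proof (rule summable_comparison_test'[where N = 0])
    show "summable (\<lambda>k. 2 * (cmod (taylor_coeff f k))\<^sup>2 + 2 * (cmod (taylor_coeff g k))\<^sup>2)"
      by (intro summable_add summable_mult hardy2_summable f g)
    show "norm ((cmod (taylor_coeff (f + g) k))\<^sup>2)
        \<le> 2 * (cmod (taylor_coeff f k))\<^sup>2 + 2 * (cmod (taylor_coeff g k))\<^sup>2" for k
      using cmod_add_square_le
      by (simp add: taylor_coeff_add hardy2_holomorphic[OF f] hardy2_holomorphic[OF g])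
  qed
qed

lemma diff_eq_add_cscale: "f - g = f + cscale (-1) g"
  by (simp add: fun_eq_iff cscale_def)

lemma hardy2_diff: "f \<in> hardy2 \<Longrightarrow> g \<in> hardy2 \<Longrightarrow> f - g \<in> hardy2"
  unfolding diff_eq_add_cscale by (intro hardy2_add hardy2_cscale)

lemma hnorm_cscale:
  assumes "f \<in> hardy2"
  shows "hnorm (cscale c f) = cmod c * hnorm f"
  unfolding hnorm_def using hardy2_summable[OF assms]
  by (simp add: taylor_coeff_cscale hardy2_holomorphic[OF assms] norm_mult power_mult_distrib
      suminf_mult real_sqrt_mult)

lemma hnorm_triangle:
  assumes f: "f \<in> hardy2" and g: "g \<in> hardy2"
  shows "hnorm (f + g) \<le> hnorm f + hnorm g"
proof -
  have part: "L2_set (\<lambda>k. cmod (taylor_coeff h k)) {..<n} \<le> hnorm h" if "h \<in> hardy2" for h n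
    unfolding L2_set_def hnorm_def
    by (intro real_sqrt_le_mono sum_le_suminf hardy2_summable that) auto
  have "(\<Sum>k<n. (cmod (taylor_coeff (f + g) k))\<^sup>2) \<le> (hnorm f + hnorm g)\<^sup>2" for n
  proof -
    have "L2_set (\<lambda>k. cmod (taylor_coeff (f + g) k)) {..<n}
        \<le> L2_set (\<lambda>k. cmod (taylor_coeff f k) + cmod (taylor_coeff g k)) {..<n}"
      by (intro L2_set_mono)
        (auto simp: taylor_coeff_add hardy2_holomorphic[OF f] hardy2_holomorphic[OF g]
          intro: norm_triangle_ineq)
    also have "\<dots> \<le> L2_set (\<lambda>k. cmod (taylor_coeff f k)) {..<n}
        + L2_set (\<lambda>k. cmod (taylor_coeff g k)) {..<n}"
      by (rule L2_set_triangle_ineq)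
    also have "\<dots> \<le> hnorm f + hnorm g"
      by (intro add_mono part f g)
    finally show ?thesis
      unfolding L2_set_def by (rule sqrt_le_D)
  qed
  then have "(\<Sum>k. (cmod (taylor_coeff (f + g) k))\<^sup>2) \<le> (hnorm f + hnorm g)\<^sup>2"
    by (intro suminf_le_const hardy2_summable hardy2_add f g)
  then show ?thesis
    unfolding hnorm_def[of "f + g"] using hnorm_nonneg[OF f] hnorm_nonneg[OF g]
    by (intro real_le_lsqrt) auto
qed

lemma hinner_summable:
  assumes f: "f \<in> hardy2" and g: "g \<in> hardy2"
  shows "summable (\<lambda>k. cnj (taylor_coeff f k) * taylor_coeff g k)"
proof (rule summable_comparison_test'[where N = 0])
  show "summable (\<lambda>k. (cmod (taylor_coeff f k))\<^sup>2 + (cmod (taylor_coeff g k))\<^sup>2)"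
    by (intro summable_add hardy2_summable f g)
  show "norm (cnj (taylor_coeff f k) * taylor_coeff g k)
      \<le> (cmod (taylor_coeff f k))\<^sup>2 + (cmod (taylor_coeff g k))\<^sup>2" for k
    using sum_squares_bound[of "cmod (taylor_coeff f k)" "cmod (taylor_coeff g k)"]
      mult_nonneg_nonneg[OF norm_ge_zero norm_ge_zero, of "taylor_coeff f k" "taylor_coeff g k"]
    by (simp only: norm_mult complex_mod_cnj)
qed

lemma hinner_diff_left:
  assumes "f \<in> hardy2" "g \<in> hardy2" "h \<in> hardy2"
  shows "hinner (f - g) h = hinner f h - hinner g h"
  unfolding hinner_def using suminf_diff[OF hinner_summable[OF assms(1,3)] hinner_summable[OF assms(2,3)]]
  by (simp add: taylor_coeff_diff hardy2_holomorphic assms algebra_simps)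

lemma hnorm_diff_square:
  assumes f: "f \<in> hardy2" and g: "g \<in> hardy2"
  shows "(hnorm (f - g))\<^sup>2 = (hnorm f)\<^sup>2 - 2 * Re (hinner f g) + (hnorm g)\<^sup>2"
proof -
  have cmod: "(cmod (a - b))\<^sup>2 = (cmod a)\<^sup>2 - 2 * Re (cnj a * b) + (cmod b)\<^sup>2" for a b
    unfolding cmod_power2 by (simp add: power2_eq_square algebra_simps)
  have Re: "Re (hinner f g) = (\<Sum>k. Re (cnj (taylor_coeff f k) * taylor_coeff g k))"
    unfolding hinner_def by (rule Re_suminf[OF hinner_summable[OF f g]])
  have sRe: "summable (\<lambda>k. Re (cnj (taylor_coeff f k) * taylor_coeff g k))"
    by (rule summable_Re[OF hinner_summable[OF f g]])
  have "(\<lambda>k. (cmod (taylor_coeff f k))\<^sup>2 - 2 * Re (cnj (taylor_coeff f k) * taylor_coeff g k)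
      + (cmod (taylor_coeff g k))\<^sup>2) sums
      ((hnorm f)\<^sup>2 - 2 * Re (hinner f g) + (hnorm g)\<^sup>2)"
    unfolding hnorm_square[OF f] hnorm_square[OF g] Re
    by (intro sums_add sums_diff sums_mult summable_sums hardy2_summable f g sRe)
  also have "(\<lambda>k. (cmod (taylor_coeff f k))\<^sup>2 - 2 * Re (cnj (taylor_coeff f k) * taylor_coeff g k)
      + (cmod (taylor_coeff g k))\<^sup>2) = (\<lambda>k. (cmod (taylor_coeff (f - g) k))\<^sup>2)"
    by (simp only: fun_eq_iff taylor_coeff_diff hardy2_holomorphic f g cmod) simp
  finally show ?thesis
    unfolding hnorm_square[OF hardy2_diff[OF f g]] by (simp only: sums_iff)
qed

lemma hnorm_eq_zero:
  assumes f: "f \<in> hardy2" and "hnorm f = 0"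
  shows "f = 0"
proof -
  have "(\<Sum>k. (cmod (taylor_coeff f k))\<^sup>2) = 0"
    using hnorm_square[OF f] assms(2) by simp
  then have coeff: "taylor_coeff f k = 0" for k
    using suminf_eq_zero_iff[OF hardy2_summable[OF f]] by simp
  have "f z = 0" for z
  proof (cases "z \<in> ball 0 1")
    case True
    show ?thesis
      using taylor_coeff_sums[OF hardy2_holomorphic[OF f] True] by (simp add: coeff sums_iff)
  qed (rule hardy2_outside[OF f])
  then show ?thesis by (simp add: fun_eq_iff)
qed

lemma
  assumes f: "f \<in> hardy2"
  shows hardy2_shift: "(\<lambda>z. z ^ m * f z) \<in> hardy2"
    and hnorm_shift: "hnorm (\<lambda>z. z ^ m * f z) = hnorm f"
proof -
  let ?g = "\<lambda>z. z ^ m * f z"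
  have coeff: "taylor_coeff ?g k = (if k < m then 0 else taylor_coeff f (k - m))" for k
    by (rule taylor_coeff_shift[OF hardy2_holomorphic[OF f]])
  have "(\<lambda>k. (cmod (taylor_coeff ?g (k + m)))\<^sup>2) = (\<lambda>k. (cmod (taylor_coeff f k))\<^sup>2)"
    by (simp add: coeff)
  then have "(\<lambda>k. (cmod (taylor_coeff ?g (k + m)))\<^sup>2) sums (\<Sum>k. (cmod (taylor_coeff f k))\<^sup>2)"
    using summable_sums[OF hardy2_summable[OF f]] by simp
  then have sums: "(\<lambda>k. (cmod (taylor_coeff ?g k))\<^sup>2) sums (\<Sum>k. (cmod (taylor_coeff f k))\<^sup>2)"
    by (subst (asm) sums_iff_shift) (simp add: coeff)
  show "?g \<in> hardy2"
    using hardy2_holomorphic[OF f] hardy2_outside[OF f] sums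
    by (intro hardy2I holomorphic_intros) (auto simp: sums_iff)
  show "hnorm ?g = hnorm f"
    using sums by (simp add: hnorm_def sums_iff)
qed

text \<open>Multiplication by \<open>z\<close> is an isometry, so that a polynomial acts by multiplication with norm at
  most the sum of the absolute values of its coefficients.\<close>

lemma hnorm_polynomial_mult:
  assumes v: "v \<in> hardy2"
  shows "(\<lambda>z. (\<Sum>k<n. c k * z ^ k) * v z) \<in> hardy2 \<and>
    hnorm (\<lambda>z. (\<Sum>k<n. c k * z ^ k) * v z) \<le> (\<Sum>k<n. cmod (c k)) * hnorm v"
proof (induction n)
  case 0
  have "(\<lambda>z. (\<Sum>k<0. c k * z ^ k) * v z) = cscale 0 v" by (simp add: cscale_def)
  then show ?case using hardy2_cscale[OF v, of 0] hnorm_cscale[OF v, of 0] by simp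
next
  case (Suc n)
  let ?p = "\<lambda>z. (\<Sum>k<n. c k * z ^ k) * v z" and ?q = "cscale (c n) (\<lambda>z. z ^ n * v z)"
  have eq: "(\<lambda>z. (\<Sum>k<Suc n. c k * z ^ k) * v z) = ?p + ?q"
    by (simp add: fun_eq_iff cscale_def distrib_right mult.assoc)
  have q: "?q \<in> hardy2" by (intro hardy2_cscale hardy2_shift v)
  have "hnorm (?p + ?q) \<le> hnorm ?p + hnorm ?q"
    using Suc.IH q by (intro hnorm_triangle) auto
  also have "\<dots> \<le> (\<Sum>k<n. cmod (c k)) * hnorm v + cmod (c n) * hnorm v"
    using Suc.IH by (simp add: hnorm_cscale hardy2_shift hnorm_shift v)
  also have "\<dots> = (\<Sum>k<Suc n. cmod (c k)) * hnorm v" by (simp add: distrib_right)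
  finally have "hnorm (?p + ?q) \<le> (\<Sum>k<Suc n. cmod (c k)) * hnorm v" .
  moreover have "?p + ?q \<in> hardy2" using Suc.IH q by (intro hardy2_add) auto
  ultimately show ?case unfolding eq by (rule conjI[rotated])
qed

text \<open>The contraction from bounded holomorphic functions with the supremum norm into the Hardy
  space, which reduces membership in the Hardy space, and later in the domain of \<open>H_op\<close>, to pointwise
  bounds in the open disc.\<close>

lemma
  assumes hol: "f holomorphic_on ball 0 1" and out: "\<And>z. z \<notin> ball 0 1 \<Longrightarrow> f z = 0"
    and bd: "\<And>z. z \<in> ball 0 1 \<Longrightarrow> cmod (f z) \<le> B"
  shows bounded_holomorphic_hardy2: "f \<in> hardy2"
    and bounded_holomorphic_hnorm: "(hnorm f)\<^sup>2 \<le> B\<^sup>2"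
proof -
  note part = bounded_holomorphic_sum_square[OF hol bd]
  have "summable (\<lambda>k. (cmod (taylor_coeff f k))\<^sup>2)"
    by (rule summableI_nonneg_bounded[where x = "B\<^sup>2"]) (use part in auto)
  then show f: "f \<in> hardy2" using hol out by (intro hardy2I)
  show "(hnorm f)\<^sup>2 \<le> B\<^sup>2"
    unfolding hnorm_square[OF f] by (intro suminf_le_const hardy2_summable f part)
qed

lemma disc_series_hardy2:
  assumes "summable (\<lambda>k. (cmod (a k))\<^sup>2)"
  shows "disc_series a \<in> hardy2" "taylor_coeff (disc_series a) k = a k"
proof -
  have "Bseq (\<lambda>k. (cmod (a k))\<^sup>2)"
    using summable_LIMSEQ_zero[OF assms] convergent_def convergent_imp_Bseq by blast
  then obtain K where K: "K > 0" "\<And>k. norm ((cmod (a k))\<^sup>2) \<le> K" unfolding Bseq_def by blast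
  have bd: "cmod (a k) \<le> sqrt K" for k using K(2)[of k] by (intro real_le_rsqrt) simp
  show "taylor_coeff (disc_series a) k = a k" by (rule taylor_coeff_disc_series[OF bd])
  show "disc_series a \<in> hardy2"
    using assms by (intro hardy2I disc_series_holomorphic[OF bd])
      (auto simp: taylor_coeff_disc_series[OF bd] disc_series_def)
qed

text \<open>Polynomials become elements of the Hardy space when they are cut off outside the disc.\<close>

definition disc_poly :: "(nat \<Rightarrow> complex) \<Rightarrow> nat \<Rightarrow> cfun" where
  "disc_poly a n = disc_series (\<lambda>k. if k < n then a k else 0)"

lemma disc_poly_eq: "z \<in> ball 0 1 \<Longrightarrow> disc_poly a n z = (\<Sum>k<n. a k * z ^ k)"
proof -
  assume z: "z \<in> ball 0 1"
  have "(\<Sum>k. (if k < n then a k else 0) * z ^ k) = (\<Sum>k<n. (if k < n then a k else 0) * z ^ k)"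
    by (intro suminf_finite) auto
  then show ?thesis using z by (simp add: disc_poly_def disc_series_def)
qed

lemma disc_poly_outside: "z \<notin> ball 0 1 \<Longrightarrow> disc_poly a n z = 0"
  by (simp add: disc_poly_def disc_series_def)

lemma
  shows disc_poly_hardy2: "disc_poly a n \<in> hardy2"
    and taylor_coeff_disc_poly: "taylor_coeff (disc_poly a n) k = (if k < n then a k else 0)"
proof -
  have s: "summable (\<lambda>k. (cmod (if k < n then a k else 0))\<^sup>2)"
    by (rule summable_finite[of "{..<n}"]) auto
  show "disc_poly a n \<in> hardy2" "taylor_coeff (disc_poly a n) k = (if k < n then a k else 0)"
    unfolding disc_poly_def using disc_series_hardy2[OF s] by simp_all
qed

lemma polynomials_dense:
  assumes f: "f \<in> hardy2" and e: "e > 0"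
  obtains n where "hnorm (f - disc_poly (taylor_coeff f) n) < e"
proof -
  let ?s = "\<lambda>k. (cmod (taylor_coeff f k))\<^sup>2"
  obtain n where n: "norm (\<Sum>i. (cmod (taylor_coeff f (i + n)))\<^sup>2) < e\<^sup>2"
    using suminf_exist_split[OF zero_less_power[OF e, of 2] hardy2_summable[OF f]] by blast
  let ?g = "f - disc_poly (taylor_coeff f) n"
  have g: "?g \<in> hardy2" by (intro hardy2_diff f disc_poly_hardy2)
  have coeff: "taylor_coeff ?g k = (if k < n then 0 else taylor_coeff f k)" for k
    unfolding taylor_coeff_diff[OF hardy2_holomorphic[OF f] hardy2_holomorphic[OF disc_poly_hardy2]]
      taylor_coeff_disc_poly by simp
  have "(hnorm ?g)\<^sup>2 = (\<Sum>i. (cmod (taylor_coeff ?g (i + n)))\<^sup>2) + (\<Sum>i<n. (cmod (taylor_coeff ?g i))\<^sup>2)"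
    unfolding hnorm_square[OF g] by (rule suminf_split_initial_segment[OF hardy2_summable[OF g]])
  also have "\<dots> = (\<Sum>i. ?s (i + n))" by (simp add: coeff)
  also have "\<dots> \<le> norm (\<Sum>i. ?s (i + n))" by (simp only: real_norm_def abs_ge_self)
  also note n
  finally have "(hnorm ?g)\<^sup>2 < e\<^sup>2" .
  then have "hnorm ?g < e" by (rule power2_less_imp_less[OF _ less_imp_le[OF e]])
  then show ?thesis by (rule that)
qed

section \<open>The domain of the operator and boundary values\<close>

lemma dom_H_op: "f \<in> dom_op H_op \<longleftrightarrow> f \<in> hardy2 \<and> zddz f \<in> hardy2"
  by (simp add: H_op_def)

lemma dom_L_op: "f \<in> dom_op (L_op F) \<longleftrightarrow> f \<in> dom_op H_op \<and> vanishes_on f F"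
  by (auto simp: L_op_def restrict_op_def)

lemma app_L_op: "app_op (L_op F) = zddz"
  by (simp add: L_op_def restrict_op_def H_op_def)

text \<open>Since \<open>p q \<le> p\<^sup>2 + q\<^sup>2\<close>, the coefficients \<open>(k a\<^sub>k) (1 / k)\<close> are absolutely
  summable as soon as \<open>k a\<^sub>k\<close> is square summable.\<close>

lemma summable_taylor_coeff_dom_H:
  assumes "f \<in> dom_op H_op"
  shows "summable (\<lambda>k. cmod (taylor_coeff f k))"
proof (rule summable_comparison_test'[where N = 1])
  have f: "f \<in> hardy2" and zf: "zddz f \<in> hardy2" using assms by (auto simp: dom_H_op)
  show "summable (\<lambda>k. (cmod (taylor_coeff (zddz f) k))\<^sup>2 + 1 / real k ^ 2)"
    by (intro summable_add hardy2_summable zf inverse_power_summable[of 2, unfolded inverse_eq_divide]) simp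
  fix k :: nat assume k: "k \<ge> 1"
  define x where "x = cmod (taylor_coeff f k)"
  have "x = (real k * x) * (1 / real k)" using k by simp
  also have "\<dots> \<le> (real k * x)\<^sup>2 + (1 / real k)\<^sup>2"
  proof -
    have "p * q \<le> p\<^sup>2 + q\<^sup>2" if "0 \<le> p" "0 \<le> q" for p q :: real
      using sum_squares_bound[of p q] mult_nonneg_nonneg[OF that] by linarith
    then show ?thesis by this (simp_all add: x_def)
  qed
  finally show "norm (cmod (taylor_coeff f k)) \<le> (cmod (taylor_coeff (zddz f) k))\<^sup>2 + 1 / real k ^ 2"
    by (simp add: x_def taylor_coeff_zddz[OF hardy2_holomorphic[OF f]] norm_mult power_divide)
qed

text \<open>The Taylor series makes sense on the closed disc for functions in the domain of \<open>H_op\<close>; there it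
  is the continuous extension to which \<open>vanishes_on\<close> refers.\<close>

definition boundary_ext :: "cfun \<Rightarrow> cfun" where
  "boundary_ext f z = (\<Sum>k. taylor_coeff f k * z ^ k)"

lemma continuous_boundary_ext:
  assumes "f \<in> dom_op H_op"
  shows "continuous_on (cball 0 1) (boundary_ext f)"
proof -
  have "uniform_limit (cball 0 1) (\<lambda>n z. \<Sum>k<n. taylor_coeff f k * z ^ k)
      (\<lambda>z. \<Sum>k. taylor_coeff f k * z ^ k) sequentially"
    by (intro Weierstrass_m_test[OF _ summable_taylor_coeff_dom_H[OF assms]])
      (auto simp: norm_mult norm_power intro!: mult_left_le power_le_one)
  then have "continuous_on (cball 0 1) (\<lambda>z. \<Sum>k. taylor_coeff f k * z ^ k)"
    by (rule uniform_limit_theorem[rotated]) (auto intro!: continuous_intros always_eventually)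
  then show ?thesis unfolding boundary_ext_def[abs_def] .
qed

lemma boundary_ext_eq:
  assumes "f \<in> hardy2" "z \<in> ball 0 1"
  shows "boundary_ext f z = f z"
  using taylor_coeff_sums[OF hardy2_holomorphic[OF assms(1)] assms(2)]
  by (simp add: boundary_ext_def sums_iff)

lemma vanishes_on_iff:
  assumes f: "f \<in> dom_op H_op" and F: "F \<subseteq> cball 0 1"
  shows "vanishes_on f F \<longleftrightarrow> (\<forall>z\<in>F. boundary_ext f z = 0)"
proof
  have f2: "f \<in> hardy2" using f by (simp add: dom_H_op)
  show "vanishes_on f F" if "\<forall>z\<in>F. boundary_ext f z = 0"
    unfolding vanishes_on_def using continuous_boundary_ext[OF f] boundary_ext_eq[OF f2] that by blast
  assume "vanishes_on f F"
  then obtain g where g: "continuous_on (cball 0 1) g" "\<And>z. z \<in> ball 0 1 \<Longrightarrow> g z = f z"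
    "\<And>z. z \<in> F \<Longrightarrow> g z = 0" unfolding vanishes_on_def by blast
  have "g z - boundary_ext f z = 0" if "z \<in> F" for z
  proof (rule continuous_constant_on_closure[where S = "ball (0::complex) 1" and f = "\<lambda>z. g z - boundary_ext f z"])
    show "continuous_on (closure (ball 0 1)) (\<lambda>z. g z - boundary_ext f z)"
      using g(1) continuous_boundary_ext[OF f] by (simp add: continuous_on_diff)
    show "z \<in> closure (ball 0 1)" using that F by auto
    show "g w - boundary_ext f w = 0" if "w \<in> ball 0 1" for w
      using g(2)[OF that] boundary_ext_eq[OF f2 that] by simp
  qed
  then show "\<forall>z\<in>F. boundary_ext f z = 0" using g(3) by auto
qed

text \<open>The criterion by which elements of the domain are produced. A bounded derivative gives
  \<open>zddz f \<in> hardy2\<close>, and a bound by the squared distance to \<open>F\<close>, valid in the open disc, passes to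
  the boundary by continuity.\<close>

lemma dom_L_opI:
  assumes hol: "f holomorphic_on ball 0 1" and out: "\<And>z. z \<notin> ball 0 1 \<Longrightarrow> f z = 0"
    and bd: "\<And>z. z \<in> ball 0 1 \<Longrightarrow> cmod (f z) \<le> B"
    and bd': "\<And>z. z \<in> ball 0 1 \<Longrightarrow> cmod (deriv f z) \<le> B'"
    and F: "F \<subseteq> cball 0 1"
    and van: "\<And>z. z \<in> ball 0 1 \<Longrightarrow> cmod (f z) \<le> C * (infdist z F)\<^sup>2"
  shows "f \<in> dom_op (L_op F)"
proof -
  have f2: "f \<in> hardy2" by (rule bounded_holomorphic_hardy2[OF hol out bd])
  have B': "B' \<ge> 0" using order_trans[OF norm_ge_zero bd'[of 0]] by simp
  have "zddz f \<in> hardy2"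
  proof (rule bounded_holomorphic_hardy2[OF zddz_holomorphic[OF hol], where B = B'])
    show "cmod (zddz f z) \<le> B'" if "z \<in> ball 0 1" for z
      using mult_mono[of "cmod z" 1 "cmod (deriv f z)" B'] bd'[OF that] that B'
      by (simp add: zddz_def norm_mult)
  qed (simp add: zddz_def)
  then have f: "f \<in> dom_op H_op" using f2 by (simp add: dom_H_op)
  have "boundary_ext f z = 0" if z: "z \<in> F" for z
  proof -
    have "cmod (boundary_ext f z) - C * (infdist z F)\<^sup>2 \<le> 0"
    proof (rule continuous_le_on_closure[where S = "ball (0::complex) 1" and f = "\<lambda>z. cmod (boundary_ext f z) - C * (infdist z F)\<^sup>2"])
      show "continuous_on (closure (ball 0 1)) (\<lambda>z. cmod (boundary_ext f z) - C * (infdist z F)\<^sup>2)"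
        using continuous_boundary_ext[OF f] by (auto intro!: continuous_intros)
      show "z \<in> closure (ball 0 1)" using z F by auto
      show "cmod (boundary_ext f w) - C * (infdist w F)\<^sup>2 \<le> 0" if "w \<in> ball 0 1" for w
        using van[OF that] boundary_ext_eq[OF f2 that] by simp
    qed
    then show ?thesis using z by simp
  qed
  then show ?thesis using vanishes_on_iff[OF f F] f by (simp add: dom_L_op)
qed

text \<open>On Taylor coefficients the operator is multiplication by the real sequence \<open>k\<close>.\<close>

lemma hermitian_L_op: "hermitian_op (L_op F)"
  unfolding hermitian_op_def app_L_op
  by (auto simp: dom_L_op dom_H_op hinner_def taylor_coeff_zddz hardy2_holomorphic ac_simps)

section \<open>Deficiency vectors\<close>

text \<open>If \<open>w\<close> is orthogonal to \<open>f\<close>, then \<open>\<parallel>w - f\<parallel>\<^sup>2 = \<parallel>w\<parallel>\<^sup>2 + \<parallel>f\<parallel>\<^sup>2\<close>, so \<open>w\<close> is no closer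
  to \<open>f\<close> than to \<open>0\<close>.\<close>

lemma orthogonal_dense_zero:
  assumes dense: "densely_defined L" and w: "w \<in> hardy2"
    and orth: "\<And>f. f \<in> dom_op L \<Longrightarrow> hinner w f = 0"
  shows "w = 0"
proof (rule hnorm_eq_zero[OF w])
  have "hnorm w \<le> 0 + e" if e: "e > 0" for e
  proof -
    obtain f where f: "f \<in> dom_op L" "hnorm (w - f) < e"
      using dense w e unfolding densely_defined_def by blast
    have f2: "f \<in> hardy2" using f dense unfolding densely_defined_def by blast
    have "(hnorm w)\<^sup>2 \<le> (hnorm (w - f))\<^sup>2"
      unfolding hnorm_diff_square[OF w f2] orth[OF f(1)] by simp
    then have "hnorm w \<le> hnorm (w - f)"
      by (rule power2_le_imp_le) (intro hnorm_nonneg hardy2_diff w f2)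
    then show ?thesis using f by simp
  qed
  then have "hnorm w \<le> 0" by (rule field_le_epsilon)
  then show "hnorm w = 0" using hnorm_nonneg[OF w] by simp
qed

text \<open>Density makes the vector in the definition of the adjoint unique, so that any solution of the
  weak eigenvalue equation is an eigenvector.\<close>

lemma eigenspace_adjointI:
  assumes dense: "densely_defined L" and g: "g \<in> hardy2"
    and eq: "\<And>f. f \<in> dom_op L \<Longrightarrow> hinner g (app_op L f) = hinner (cscale c g) f"
  shows "g \<in> eigenspace_op (adjoint_op L) c"
proof -
  have cg: "cscale c g \<in> hardy2" by (rule hardy2_cscale[OF g])
  have "(THE h. h \<in> hardy2 \<and> (\<forall>f\<in>dom_op L. hinner g (app_op L f) = hinner h f)) = cscale c g"
  proof (rule the_equality)
    fix h assume h: "h \<in> hardy2 \<and> (\<forall>f\<in>dom_op L. hinner g (app_op L f) = hinner h f)"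
    have "h - cscale c g = 0"
    proof (rule orthogonal_dense_zero[OF dense])
      show "h - cscale c g \<in> hardy2" using h cg by (simp add: hardy2_diff)
      show "hinner (h - cscale c g) f = 0" if "f \<in> dom_op L" for f
      proof -
        have "f \<in> hardy2" using that dense unfolding densely_defined_def by blast
        then show ?thesis using h cg eq[OF that] that by (auto simp: hinner_diff_left)
      qed
    qed
    then show "h = cscale c g" by simp
  qed (use cg eq in auto)
  then show ?thesis
    using g cg eq by (auto simp: eigenspace_op_def adjoint_op_def)
qed

lemma of_nat_minus_nonreal_nonzero:
  assumes "cmod c = 1" "Re c = 0"
  shows "of_nat k - c \<noteq> 0"
proof
  assume "of_nat k - c = 0"
  then have "c = of_nat k" by simp
  then show False using assms by auto
qed

text \<open>The functional \<open>f \<mapsto> f w\<close> is bounded in the graph norm of \<open>H_op\<close>, and the function below represents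
  it: \<open>\<langle>g, H f\<rangle> - \<langle>c g, f\<rangle> = f w\<close> for \<open>g = deficiency_vector c w\<close>, where \<open>f w\<close> is the
  boundary value. In coefficients this says
  \<open>cnj g\<^sub>k (k - cnj c) = w ^ k\<close>.\<close>

definition deficiency_vector :: "complex \<Rightarrow> complex \<Rightarrow> cfun" where
  "deficiency_vector c w = disc_series (\<lambda>k. cnj w ^ k / (of_nat k - c))"

lemma
  assumes c: "cmod c = 1" "Re c = 0" and w: "cmod w = 1"
  shows deficiency_vector_hardy2: "deficiency_vector c w \<in> hardy2"
    and taylor_coeff_deficiency_vector:
      "taylor_coeff (deficiency_vector c w) k = cnj w ^ k / (of_nat k - c)"
proof -
  have s: "summable (\<lambda>k. (cmod (cnj w ^ k / (of_nat k - c)))\<^sup>2)"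
  proof (rule summable_comparison_test'[where N = 1])
    show "summable (\<lambda>k. 1 / real k ^ 2)"
      using inverse_power_summable[of 2, where 'a = real] by (simp add: inverse_eq_divide)
    fix k :: nat assume k: "k \<ge> 1"
    have "real k \<le> cmod (of_nat k - c)"
      using complex_Re_le_cmod[of "of_nat k - c"] c by simp
    then have "(real k)\<^sup>2 \<le> (cmod (of_nat k - c))\<^sup>2" by (intro power_mono) auto
    then have "1 / (cmod (of_nat k - c))\<^sup>2 \<le> 1 / (real k)\<^sup>2"
      using k by (intro frac_le) auto
    then show "norm ((cmod (cnj w ^ k / (of_nat k - c)))\<^sup>2) \<le> 1 / real k ^ 2"
      using w by (simp add: norm_divide norm_power power_divide)
  qed
  show "deficiency_vector c w \<in> hardy2"
    "taylor_coeff (deficiency_vector c w) k = cnj w ^ k / (of_nat k - c)"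
    unfolding deficiency_vector_def using disc_series_hardy2[OF s] by simp_all
qed

lemma deficiency_vector_eigen:
  assumes c: "cmod c = 1" "Re c = 0" and F: "F \<subseteq> sphere 0 1" and w: "w \<in> F"
    and dense: "densely_defined (L_op F)"
  shows "deficiency_vector c w \<in> eigenspace_op (adjoint_op (L_op F)) c"
proof (rule eigenspace_adjointI[OF dense])
  have w1: "cmod w = 1" using w F by auto
  let ?g = "deficiency_vector c w"
  note g = deficiency_vector_hardy2[OF c w1] and coeff = taylor_coeff_deficiency_vector[OF c w1]
  show "?g \<in> hardy2" by (rule g)
  fix f assume "f \<in> dom_op (L_op F)"
  then have fH: "f \<in> dom_op H_op" and van: "vanishes_on f F" by (auto simp: dom_L_op)
  then have f: "f \<in> hardy2" and zf: "zddz f \<in> hardy2" by (auto simp: dom_H_op)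
  have "F \<subseteq> cball 0 1" using F by auto
  then have "boundary_ext f w = 0" using vanishes_on_iff[OF fH] van w by simp
  moreover have "hinner ?g (zddz f) - hinner (cscale c ?g) f = boundary_ext f w"
  proof -
    note cneq = of_nat_minus_nonreal_nonzero[OF c]
    have "cnj (cnj w ^ k / (of_nat k - c)) * (of_nat k * x) - cnj (c * (cnj w ^ k / (of_nat k - c))) * x
        = x * w ^ k" for k x
    proof -
      have nz: "of_nat k - cnj c \<noteq> 0"
        using cneq[of k] by (metis complex_cnj_cnj complex_cnj_diff complex_cnj_of_nat complex_cnj_zero)
      have "y / d * ((d + e) * x) - e * (y / d) * x = x * y" if "d \<noteq> 0" for d e y :: complex
        using that by (simp add: field_simps)
      from this[OF nz, of "w ^ k" "cnj c"] show ?thesis by simp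
    qed
    then have "(\<lambda>k. cnj (taylor_coeff ?g k) * taylor_coeff (zddz f) k
        - cnj (taylor_coeff (cscale c ?g) k) * taylor_coeff f k) = (\<lambda>k. taylor_coeff f k * w ^ k)"
      unfolding taylor_coeff_zddz[OF hardy2_holomorphic[OF f]]
        taylor_coeff_cscale[OF hardy2_holomorphic[OF g]] coeff by (simp only:)
    then show ?thesis
      unfolding hinner_def boundary_ext_def
      by (simp add: suminf_diff hinner_summable g f zf hardy2_cscale)
  qed
  ultimately show "hinner ?g (app_op (L_op F) f) = hinner (cscale c ?g) f"
    by (simp add: app_L_op)
qed

text \<open>The hypothesis says that the functional \<open>p \<mapsto> \<Sum>v\<in>S. u v * p (w v)\<close> kills the monomials, hence
  all polynomials; evaluate it at the polynomial that vanishes at every node except \<open>w v\<close>.\<close>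

lemma geometric_sequences_independent:
  fixes u :: "'i \<Rightarrow> complex"
  assumes S: "finite S" "inj_on w S" and sum0: "\<And>k. (\<Sum>v\<in>S. u v * w v ^ k) = 0" and v: "v \<in> S"
  shows "u v = 0"
proof -
  define p where "p = (\<Prod>x\<in>S - {v}. [:- w x, 1:])"
  have p: "poly p x = (\<Sum>k\<le>degree p. coeff p k * x ^ k)" for x by (rule poly_altdef)
  have "(\<Sum>x\<in>S. u x * poly p (w x)) = (\<Sum>x\<in>S. \<Sum>k\<le>degree p. coeff p k * (u x * w x ^ k))"
    unfolding p sum_distrib_left by (intro sum.cong refl) (simp add: ac_simps)
  also have "\<dots> = (\<Sum>k\<le>degree p. \<Sum>x\<in>S. coeff p k * (u x * w x ^ k))" by (rule sum.swap)
  also have "\<dots> = 0" by (simp add: sum0 flip: sum_distrib_left)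
  finally have "(\<Sum>x\<in>S. u x * poly p (w x)) = 0" .
  moreover have "(\<Sum>x\<in>S. u x * poly p (w x)) = (\<Sum>x\<in>{v}. u x * poly p (w x))"
    using S v by (intro sum.mono_neutral_right) (auto simp: p_def poly_prod)
  moreover have "poly p (w v) \<noteq> 0"
    using S v by (auto simp: p_def poly_prod dest: inj_onD)
  ultimately show ?thesis by simp
qed

interpretation cfun: vector_space cscale by (rule vector_space_cscale)

lemma cdim_infinite:
  assumes X: "infinite X" "cfun.independent X" "X \<subseteq> V"
  shows "cdim V = \<infinity>"
proof -
  have "\<not> V \<subseteq> cfun.span B" if B: "finite B" for B
    using cfun.independent_span_bound[OF B X(2)] X by auto
  then show ?thesis by (auto simp: cdim_def)
qed

lemma taylor_coeff_sum_cscale: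
  assumes S: "finite S" and f: "\<And>x. x \<in> S \<Longrightarrow> f x \<in> hardy2"
  shows "(\<Sum>x\<in>S. cscale (u x) (f x)) \<in> hardy2 \<and>
    taylor_coeff (\<Sum>x\<in>S. cscale (u x) (f x)) k = (\<Sum>x\<in>S. u x * taylor_coeff (f x) k)"
  using S f
proof (induction S)
  case empty
  have "taylor_coeff 0 k = 0"
    using taylor_coeff_fps[OF has_fps_expansion_0] by (simp add: zero_fun_def)
  moreover have "0 \<in> hardy2"
    using hardy2_cscale[OF disc_poly_hardy2, of 0] by (simp add: cscale_def zero_fun_def)
  ultimately show ?case by (simp add: zero_fun_def)
next
  case (insert x S)
  let ?s = "\<Sum>x\<in>S. cscale (u x) (f x)"
  have fx: "f x \<in> hardy2" and s: "?s \<in> hardy2"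
    and coeff: "taylor_coeff ?s k = (\<Sum>x\<in>S. u x * taylor_coeff (f x) k)"
    using insert by auto
  have "(\<Sum>x\<in>insert x S. cscale (u x) (f x)) = cscale (u x) (f x) + ?s"
    by (rule sum.insert[OF insert.hyps])
  moreover have "cscale (u x) (f x) + ?s \<in> hardy2" by (intro hardy2_add hardy2_cscale fx s)
  moreover have "taylor_coeff (cscale (u x) (f x) + ?s) k
      = (\<Sum>x\<in>insert x S. u x * taylor_coeff (f x) k)"
    unfolding sum.insert[OF insert.hyps] coeff[symmetric]
    by (subst taylor_coeff_add)
      (simp_all only: taylor_coeff_cscale hardy2_holomorphic hardy2_cscale fx s)
  ultimately show ?case by (simp only: simp_thms)
qed

text \<open>Each point of \<open>F\<close> contributes a deficiency vector. The coefficient sequence of that vector is the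
  geometric sequence of \<open>cnj w\<close> with its terms divided by \<open>k - c\<close>, so distinct points give
  independent vectors.\<close>

lemma cdim_deficiency:
  assumes c: "cmod c = 1" "Re c = 0" and F: "F \<subseteq> sphere 0 1" "infinite F"
    and dense: "densely_defined (L_op F)"
  shows "cdim (eigenspace_op (adjoint_op (L_op F)) c) = \<infinity>"
proof (rule cdim_infinite)
  let ?d = "deficiency_vector c"
  have F1: "cmod w = 1" if "w \<in> F" for w using that F by auto
  note cneq = of_nat_minus_nonreal_nonzero[OF c]
  have inj: "inj_on ?d F"
  proof (rule inj_onI)
    fix v w assume vw: "v \<in> F" "w \<in> F" "?d v = ?d w"
    have "taylor_coeff (?d v) 1 = taylor_coeff (?d w) 1" using vw by simp
    then show "v = w"
      using cneq[of 1] by (simp add: taylor_coeff_deficiency_vector[OF c] F1[OF vw(1)] F1[OF vw(2)])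
  qed
  then show "infinite (?d ` F)" using F(2) by (simp add: finite_image_iff)
  show "?d ` F \<subseteq> eigenspace_op (adjoint_op (L_op F)) c"
    using deficiency_vector_eigen[OF c F(1) _ dense] by auto
  show "cfun.independent (?d ` F)"
    unfolding cfun.independent_explicit_module
  proof (intro allI impI)
    fix T u x
    assume T: "finite T" "T \<subseteq> ?d ` F" "(\<Sum>v\<in>T. cscale (u v) v) = 0" "x \<in> T"
    obtain S where S: "S \<subseteq> F" "T = ?d ` S" using T(2) by (meson subset_imageE)
    have injS: "inj_on ?d S" using inj S(1) by (rule inj_on_subset)
    have finS: "finite S" using T(1) S(2) injS by (simp add: finite_image_iff)
    obtain y where y: "y \<in> S" "x = ?d y" using T(4) S(2) by auto
    have d: "?d v \<in> hardy2" if "v \<in> S" for v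
      using that S(1) F1 by (intro deficiency_vector_hardy2[OF c]) auto
    have "(\<Sum>v\<in>S. u (?d v) * cnj v ^ k) = 0" for k
    proof -
      have "(\<Sum>v\<in>S. cscale (u (?d v)) (?d v)) = 0"
        using T(3) unfolding S(2) sum.reindex[OF injS] o_def .
      then have "(\<Sum>v\<in>S. u (?d v) * taylor_coeff (?d v) k) = taylor_coeff 0 k"
        using taylor_coeff_sum_cscale[OF finS, of ?d "\<lambda>v. u (?d v)" k, OF d] by simp
      also have "\<dots> = 0"
        using taylor_coeff_fps[OF has_fps_expansion_0] by (simp add: zero_fun_def)
      finally have "(\<Sum>v\<in>S. u (?d v) * (cnj v ^ k / (of_nat k - c))) = 0"
        using S(1) F1 by (simp add: taylor_coeff_deficiency_vector[OF c] subset_iff cong: sum.cong)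
      then have "(\<Sum>v\<in>S. u (?d v) * cnj v ^ k) / (of_nat k - c) = 0"
        by (simp add: sum_divide_distrib)
      then show ?thesis using cneq[of k] by simp
    qed
    then have "u (?d y) = 0"
      by (intro geometric_sequences_independent[OF finS, of cnj "\<lambda>v. u (?d v)"] y) (auto intro: inj_onI)
    then show "u x = 0" using y by simp
  qed
qed

section \<open>Nets and Carleson's condition\<close>

lemma cis_measurable: "cis \<in> borel_measurable borel"
  by (intro borel_measurable_continuous_onI continuous_intros)

lemma sets_circle_haar [measurable_cong, simp]: "sets circle_haar = sets borel"
  by (simp add: circle_haar_def)

lemma space_circle_haar [simp]: "space circle_haar = UNIV"
  by (simp add: circle_haar_def)

lemma measure_circle_haar:
  assumes "A \<in> sets borel"
  shows "measure circle_haar A = measure lborel ({0..<2 * pi} \<inter> cis -` A) / (2 * pi)"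
proof -
  have cis: "cis \<in> uniform_measure lborel {0..<2 * pi} \<rightarrow>\<^sub>M borel"
    using cis_measurable by simp
  have "cis -` A \<in> sets borel"
    using measurable_sets[OF cis_measurable assms] by simp
  then show ?thesis
    unfolding circle_haar_def using assms
    by (simp add: measure_distr[OF cis] measure_uniform_measure)
qed

lemma finite_measure_circle_haar: "finite_measure circle_haar"
proof
  have "emeasure circle_haar (space circle_haar) = 1"
    unfolding circle_haar_def using cis_measurable
    by (subst emeasure_distr) (auto simp: emeasure_uniform_measure_1)
  then show "emeasure circle_haar (space circle_haar) \<noteq> \<infinity>" by simp
qed

lemma cmod_cis_diff_le: "cmod (cis t - cis s) \<le> \<bar>t - s\<bar>"
proof -
  have "cis t - cis s = cis s * (cis (t - s) - 1)"
    by (simp add: algebra_simps cis_mult)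
  then have "cmod (cis t - cis s) = cmod (cis (t - s) - 1)" by (simp add: norm_mult)
  also have "\<dots> = 2 * \<bar>sin ((t - s) / 2)\<bar>"
    using dist_exp_i_1[of "t - s"] by (simp add: cis_conv_exp)
  also have "\<dots> \<le> \<bar>t - s\<bar>"
    using abs_sin_x_le_abs_x[of "(t - s) / 2"] by simp
  finally show ?thesis .
qed

lemma measure_circle_haar_ball:
  assumes w: "cmod w = 1" and r: "0 < r" "r \<le> 1"
  shows "measure circle_haar (ball w r) \<ge> r / (2 * pi)"
proof -
  obtain s where s: "0 \<le> s" "s < 2 * pi" "w = cis s"
    using w by (metis complex_unit_circle cmod_power2 one_power2 sincos_total_2pi cis.ctr complex_eq_iff complex.sel)
  \<comment> \<open>Half of the arc about \<open>w\<close>, on the side where the parameter does not leave \<open>[0, 2 pi)\<close>.\<close>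
  define I where "I = (if s + r \<le> 2 * pi then {s<..<s + r} else {s - r<..<s})"
  have "I \<subseteq> {0..<2 * pi} \<inter> cis -` ball w r"
  proof
    fix t assume t: "t \<in> I"
    then have "\<bar>t - s\<bar> < r" by (auto simp: I_def split: if_splits)
    then have "cmod (cis t - cis s) < r" using cmod_cis_diff_le[of t s] by simp
    moreover have "0 \<le> t \<and> t < 2 * pi"
      using t s r pi_gt3 by (auto simp: I_def split: if_splits)
    ultimately show "t \<in> {0..<2 * pi} \<inter> cis -` ball w r"
      using s by (simp add: dist_norm norm_minus_commute)
  qed
  moreover have "cis -` ball w r \<in> sets borel"
    using measurable_sets[OF cis_measurable, of "ball w r"] by simp
  moreover have "emeasure lborel ({0..<2 * pi} \<inter> cis -` ball w r) \<noteq> \<infinity>"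
    using emeasure_mono[of "{0..<2 * pi} \<inter> cis -` ball w r" "{0..<2 * pi}" lborel]
    by (auto simp: top_unique)
  ultimately have "measure lborel I \<le> measure lborel ({0..<2 * pi} \<inter> cis -` ball w r)"
    by (intro measure_mono_fmeasurable fmeasurableI) (auto simp: I_def less_top)
  moreover have "measure lborel I = r" using r by (simp add: I_def)
  ultimately show ?thesis by (simp add: measure_circle_haar divide_right_mono)
qed

lemma sets_neighbourhood: "{z. infdist z F < (r::real)} \<in> sets borel"
  by (intro borel_open open_Collect_less continuous_intros)

text \<open>Among the \<open>r\<close>-separated subsets of \<open>F\<close> take one of maximal cardinality; maximality makes it an
  \<open>r\<close>-net. The cardinality of a separated set is bounded because the balls of radius \<open>r / 2\<close> about its
  points are disjoint, lie in the \<open>r\<close>-neighbourhood of \<open>F\<close>, and carry measure at least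
  \<open>r / (4 pi)\<close> each.\<close>

lemma separated_net:
  fixes F :: "complex set"
  assumes F: "F \<subseteq> sphere 0 1" and r: "0 < r" "r \<le> 1"
  obtains S where "finite S" "S \<subseteq> F" "F \<subseteq> (\<Union>s\<in>S. ball s r)"
    "r * real (card S) \<le> 4 * pi * measure circle_haar {z. infdist z F < r}"
proof -
  interpret finite_measure circle_haar by (rule finite_measure_circle_haar)
  let ?m = "measure circle_haar {z. infdist z F < r}"
  define sep where "sep T \<longleftrightarrow> finite T \<and> T \<subseteq> F \<and> (\<forall>s\<in>T. \<forall>t\<in>T. s \<noteq> t \<longrightarrow> dist s t \<ge> r)" for T
  have bound: "r * real (card T) \<le> 4 * pi * ?m" if "sep T" for T
  proof -
    have T: "finite T" "T \<subseteq> F" "\<And>s t. s \<in> T \<Longrightarrow> t \<in> T \<Longrightarrow> s \<noteq> t \<Longrightarrow> dist s t \<ge> r"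
      using that by (auto simp: sep_def)
    have disj: "disjoint_family_on (\<lambda>s. ball s (r / 2)) T"
      unfolding disjoint_family_on_def
    proof (intro ballI impI)
      fix s t assume st: "s \<in> T" "t \<in> T" "s \<noteq> t"
      show "ball s (r / 2) \<inter> ball t (r / 2) = {}"
        using T(3)[OF st] by (intro disjoint_ballI) simp
    qed
    have "real (card T) * (r / 2 / (2 * pi)) = (\<Sum>s\<in>T. r / 2 / (2 * pi))" by simp
    also have "\<dots> \<le> (\<Sum>s\<in>T. measure circle_haar (ball s (r / 2)))"
      using T(2) F r by (intro sum_mono measure_circle_haar_ball) auto
    also have "\<dots> = measure circle_haar (\<Union>s\<in>T. ball s (r / 2))"
      by (intro finite_measure_finite_Union[symmetric] T(1) disj) auto
    also have "\<dots> \<le> ?m"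
    proof (rule finite_measure_mono)
      show "(\<Union>s\<in>T. ball s (r / 2)) \<subseteq> {z. infdist z F < r}"
      proof clarify
        fix s z assume s: "s \<in> T" "z \<in> ball s (r / 2)"
        then have "infdist z F \<le> dist z s" using T(2) by (intro infdist_le) auto
        then show "infdist z F < r" using s r by (simp add: dist_commute)
      qed
      show "{z. infdist z F < r} \<in> sets circle_haar" by (simp add: sets_neighbourhood)
    qed
    finally show ?thesis using r by (simp add: field_simps)
  qed
  have "\<exists>T. sep T \<and> (\<forall>T'. sep T' \<longrightarrow> card T' \<le> card T)"
  proof (rule ex_has_greatest_nat)
    show "sep {}" by (simp add: sep_def)
    show "\<forall>T. sep T \<longrightarrow> card T < Suc (nat \<lceil>4 * pi * ?m / r\<rceil>)"
    proof (intro allI impI)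
      fix T assume "sep T"
      then have "real (card T) \<le> 4 * pi * ?m / r" using bound[of T] r by (simp add: field_simps)
      also have "\<dots> \<le> real (nat \<lceil>4 * pi * ?m / r\<rceil>)" by (rule real_nat_ceiling_ge)
      finally show "card T < Suc (nat \<lceil>4 * pi * ?m / r\<rceil>)" by simp
    qed
  qed
  then obtain S where S: "sep S" "\<And>T. sep T \<Longrightarrow> card T \<le> card S" by blast
  have "z \<in> (\<Union>s\<in>S. ball s r)" if z: "z \<in> F" for z
  proof (rule ccontr)
    assume "z \<notin> (\<Union>s\<in>S. ball s r)"
    then have far: "\<And>s. s \<in> S \<Longrightarrow> dist s z \<ge> r" by force
    then have "z \<notin> S" using r by force
    moreover have "sep (insert z S)"
      using S(1) z far by (auto simp: sep_def dist_commute)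
    ultimately show False using S(2)[of "insert z S"] S(1) by (simp add: sep_def)
  qed
  then have "F \<subseteq> (\<Union>s\<in>S. ball s r)" by (rule subsetI)
  moreover have "finite S" "S \<subseteq> F" using S(1) by (auto simp: sep_def)
  ultimately show ?thesis using that bound[OF S(1)] by blast
qed

lemma card_halvings_above_le:
  fixes d :: real
  assumes d: "d > 0"
  shows "real (card {n. n < M \<and> d < (1 / 2) ^ n}) \<le> 1 + \<bar>ln d\<bar> / ln 2"
proof -
  let ?x = "\<bar>ln d\<bar> / ln 2"
  have "{n. n < M \<and> d < (1 / 2) ^ n} \<subseteq> {..<nat \<lceil>?x\<rceil>}"
  proof
    fix n assume "n \<in> {n. n < M \<and> d < (1 / 2) ^ n}"
    then have "ln d < ln ((1 / 2) ^ n)" using d by (subst ln_less_cancel_iff) auto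
    also have "\<dots> = - (real n * ln 2)" by (simp add: ln_realpow ln_div)
    finally have "real n * ln 2 < \<bar>ln d\<bar>" by simp
    then have "real n < ?x" by (simp add: field_simps)
    then show "n \<in> {..<nat \<lceil>?x\<rceil>}" by (simp add: zless_nat_eq_int_zless less_ceiling_iff)
  qed
  then have "card {n. n < M \<and> d < (1 / 2) ^ n} \<le> card {..<nat \<lceil>?x\<rceil>}"
    by (rule card_mono[OF finite_lessThan])
  then have "real (card {n. n < M \<and> d < (1 / 2) ^ n}) \<le> real (nat \<lceil>?x\<rceil>)"
    unfolding card_lessThan by (rule of_nat_mono)
  also have "\<dots> \<le> 1 + ?x"
  proof -
    have "?x \<ge> 0" by simp
    then show ?thesis by linarith
  qed
  finally show ?thesis .
qed

text \<open>A point at distance \<open>d > 0\<close> from \<open>F\<close> lies in the \<open>2\<^sup>-\<^sup>n\<close>-neighbourhood for at most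
  \<open>1 + \<bar>ln d\<bar> / ln 2\<close> values of \<open>n\<close>, so integrating the number of such neighbourhoods bounds the sum of
  their measures by Carleson's integral. The points of \<open>F\<close> itself lie in all of them, and it is
  here that \<open>F\<close> has to be a null set.\<close>

lemma carleson_summable:
  assumes F: "closed F" "F \<noteq> {}" and null: "emeasure circle_haar F = 0"
    and carl: "carleson_condition F"
  shows "summable (\<lambda>n. measure circle_haar {z. infdist z F < (1 / 2) ^ n})"
proof -
  interpret finite_measure circle_haar by (rule finite_measure_circle_haar)
  let ?A = "\<lambda>n. {z. infdist z F < (1 / 2) ^ n}"
  let ?h = "\<lambda>z. 1 + \<bar>ln (infdist z F)\<bar> / ln 2"
  have int: "integrable circle_haar ?h"
    using carl unfolding carleson_condition_def
    by (intro Bochner_Integration.integrable_add integrable_divide integrable_abs) auto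
  have A: "?A n \<in> sets circle_haar" for n by (simp add: sets_neighbourhood)
  have inA: "integrable circle_haar (indicator (?A n) :: complex \<Rightarrow> real)" for n
    by (rule integrable_real_indicator) (use A in \<open>auto simp: less_top[symmetric]\<close>)
  have ae: "AE z in circle_haar. z \<notin> F"
    using null F(1) by (intro AE_not_in) (auto simp: null_sets_def)
  have part: "(\<Sum>n<M. measure circle_haar (?A n)) \<le> (\<integral>z. ?h z \<partial>circle_haar)" for M
  proof -
    have "(\<Sum>n<M. measure circle_haar (?A n)) = (\<integral>z. (\<Sum>n<M. indicator (?A n) z) \<partial>circle_haar)"
      using inA by (subst Bochner_Integration.integral_sum) auto
    also have "\<dots> \<le> (\<integral>z. ?h z \<partial>circle_haar)"
    proof (rule integral_mono_AE)
      show "integrable circle_haar (\<lambda>z. \<Sum>n<M. indicator (?A n) z :: real)"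
        using inA by (intro Bochner_Integration.integrable_sum)
      show "AE z in circle_haar. (\<Sum>n<M. indicator (?A n) z) \<le> ?h z"
        using ae
      proof eventually_elim
        fix z assume "z \<notin> F"
        then have d: "infdist z F > 0" using F by (simp add: infdist_pos_not_in_closed)
        have "(\<Sum>n<M. indicator (?A n) z :: real) = real (card {n. n < M \<and> infdist z F < (1 / 2) ^ n})"
          by (simp add: indicator_def sum.If_cases lessThan_def Int_def)
        also have "\<dots> \<le> ?h z" by (rule card_halvings_above_le[OF d])
        finally show "(\<Sum>n<M. indicator (?A n) z) \<le> ?h z" .
      qed
    qed (rule int)
    finally show ?thesis .
  qed
  show ?thesis by (rule summableI_nonneg_bounded[OF _ part]) simp
qed

section \<open>Bounded functions vanishing on the boundary set\<close>

text \<open>The function \<open>1 / (1 + r - cnj s * z)\<close> has its pole at distance \<open>r\<close> behind the boundary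
  point \<open>s\<close>. It maps the disc into the right half plane, and within distance \<open>2 r\<close> of \<open>s\<close> its real
  part has the full order \<open>1 / r\<close>.\<close>

lemma
  fixes s z :: complex and r :: real
  assumes s: "cmod s = 1" and z: "cmod z < 1" and r: "r > 0"
  defines "x \<equiv> 1 + of_real r - cnj s * z"
  shows pole_distance_ge: "cmod x \<ge> dist z s" and pole_nonzero: "x \<noteq> 0"
    and pole_distance_ge': "cmod x \<ge> 1 - cmod z"
    and Re_kernel_nonneg: "Re (1 / x) \<ge> 0"
    and Re_kernel_ge: "dist z s < 2 * r \<Longrightarrow> Re (1 / x) \<ge> 1 / (9 * r)"
proof -
  define y where "y = 1 - cnj s * z"
  have xy: "x = y + of_real r" by (simp add: x_def y_def)
  have "y = cnj s * (s - z)"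
    using s by (simp add: y_def right_diff_distrib complex_norm_square[symmetric] mult.commute[of "cnj s" s])
  then have ny: "cmod y = dist z s" using s by (simp add: norm_mult dist_norm norm_minus_commute)
  have nsz: "cmod (cnj s * z) = cmod z" using s by (simp add: norm_mult)
  have Rey: "Re y \<ge> 1 - cmod z" using complex_Re_le_cmod[of "cnj s * z"] nsz by (simp add: y_def)
  have "(cmod y)\<^sup>2 \<le> (cmod x)\<^sup>2"
    unfolding cmod_power2 using Rey z r by (auto simp: xy intro!: power_mono)
  then have yx: "cmod y \<le> cmod x" by (rule power2_le_imp_le) simp
  then show "cmod x \<ge> dist z s" by (simp add: ny)
  have Rex: "Re x \<ge> r" "Re x \<ge> 1 - cmod z" using Rey z r by (simp_all add: xy)
  then show x0: "x \<noteq> 0" using r by auto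
  show "cmod x \<ge> 1 - cmod z" using Rex complex_Re_le_cmod[of x] by simp
  have Re1: "Re (1 / x) = Re x / (cmod x)\<^sup>2" by (simp add: Re_divide cmod_power2)
  show "Re (1 / x) \<ge> 0" unfolding Re1 using Rex r by simp
  show "Re (1 / x) \<ge> 1 / (9 * r)" if "dist z s < 2 * r"
  proof -
    have "cmod x \<le> cmod y + r" using norm_triangle_ineq[of y "of_real r"] r by (simp add: xy)
    then have "cmod x \<le> 3 * r" using that ny by simp
    then have "(cmod x)\<^sup>2 \<le> (3 * r)\<^sup>2" by (intro power_mono) auto
    then have "r / (3 * r)\<^sup>2 \<le> Re x / (cmod x)\<^sup>2"
      using Rex r x0 by (intro frac_le) auto
    then show ?thesis unfolding Re1 using r by (simp add: power2_eq_square)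
  qed
qed

lemma exp_minus_two_le: "exp (- 2 * real K) \<le> (1 / 4) ^ K"
proof -
  have "exp (- 1) \<le> (1 / 2 :: real)"
    using exp_ge_add_one_self[of 1] by (simp add: exp_minus field_simps)
  then have "exp (- 1) ^ 2 \<le> (1 / 2 :: real) ^ 2" by (intro power_mono) auto
  then have "exp (- 2) \<le> (1 / 4 :: real)"
    by (simp add: exp_of_nat_mult[symmetric] power2_eq_square exp_add[symmetric])
  then have "exp (- 2) ^ K \<le> (1 / 4 :: real) ^ K" by (intro power_mono) auto
  then show ?thesis by (simp add: exp_of_nat_mult[symmetric] mult.commute)
qed

text \<open>The function is \<open>u = exp (- 18 g)\<close> with \<open>g\<close> the sum over all scales \<open>2\<^sup>-\<^sup>n\<close>, \<open>n \<ge> N\<close>, and over all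
  points \<open>s\<close> of the net of that scale of \<open>2\<^sup>-\<^sup>n / (1 + 2\<^sup>-\<^sup>n - cnj s * z)\<close>. At distance \<open>d\<close> from
  \<open>F\<close>, every scale above \<open>d\<close> adds at least \<open>1 / 9\<close> to \<open>Re g\<close>, so \<open>Re g\<close> grows at least like \<open>log (1 / d)\<close>
  and \<open>u\<close> is at most of order \<open>d\<^sup>2\<close>. The derivative of \<open>g\<close> is at most of order \<open>1 / d\<^sup>2\<close>, because the
  poles stay at distance \<open>d\<close> and the weights are summable; the two orders cancel in
  \<open>u' = - 18 g' u\<close>. Finally \<open>g 0\<close> is bounded by the tail of the weights, so \<open>u 0\<close> is close to \<open>1\<close> for
  large \<open>N\<close>.\<close>

lemma exists_vanishing_function:
  fixes F :: "complex set" and S :: "nat \<Rightarrow> complex set"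
  assumes F: "F \<subseteq> sphere 0 1" "F \<noteq> {}"
    and fin: "\<And>n. finite (S n)" and sub: "\<And>n. S n \<subseteq> F"
    and cover: "\<And>n. F \<subseteq> (\<Union>s\<in>S n. ball s ((1 / 2) ^ n))"
    and summ: "summable (\<lambda>n. (1 / 2) ^ n * real (card (S n)))" and e: "e > 0"
  obtains u A B where "u holomorphic_on ball 0 1"
    "\<And>z. z \<in> ball 0 1 \<Longrightarrow> cmod (u z) \<le> 1"
    "\<And>z. z \<in> ball 0 1 \<Longrightarrow> cmod (u z) \<le> A * (infdist z F)\<^sup>2"
    "\<And>z. z \<in> ball 0 1 \<Longrightarrow> cmod (deriv u z) \<le> B"
    "cmod (u 0 - 1) < e"
proof -
  have S1: "cmod s = 1" if "s \<in> S n" for s n using that sub F by fastforce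
  define r :: "nat \<Rightarrow> real" where "r n = (1 / 2) ^ n" for n
  have r: "r n > 0" for n by (simp add: r_def)
  \<comment> \<open>\<open>m n\<close> is the total weight of scale \<open>n\<close>, and \<open>t n\<close>, \<open>t' n\<close> are its part of \<open>g\<close> and of the derivative.\<close>
  define m where "m n = r n * real (card (S n))" for n
  have m0: "m n \<ge> 0" for n using r[of n] by (simp add: m_def)
  have summ: "summable m" using summ unfolding m_def[abs_def] r_def[abs_def] .
  define t where "t n z = of_real (r n) * (\<Sum>s\<in>S n. 1 / (1 + of_real (r n) - cnj s * z))" for n z
  define t' where "t' n z = of_real (r n) * (\<Sum>s\<in>S n. cnj s / (1 + of_real (r n) - cnj s * z)\<^sup>2)" for n z
  have deriv_t: "(t n has_field_derivative t' n z) (at z)" if "z \<in> ball 0 1" for n z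
  proof -
    have "((\<lambda>z. 1 / (1 + of_real (r n) - cnj s * z)) has_field_derivative
        cnj s / (1 + of_real (r n) - cnj s * z)\<^sup>2) (at z)" if "s \<in> S n" for s
      using pole_nonzero[OF S1[OF that] _ r, of z n] \<open>z \<in> ball 0 1\<close>
      by (auto intro!: derivative_eq_intros simp: power2_eq_square)
    then show ?thesis unfolding t_def t'_def by (intro DERIV_cmult DERIV_sum)
  qed
  have sum_bound: "cmod (of_real (r n) * (\<Sum>s\<in>S n. f s)) \<le> m n * b" if "\<And>s. s \<in> S n \<Longrightarrow> cmod (f s) \<le> b" for n f b
  proof -
    have "cmod (\<Sum>s\<in>S n. f s) \<le> real (card (S n)) * b" by (rule sum_norm_bound[OF that])
    then show ?thesis
      using mult_left_mono[of "cmod (\<Sum>s\<in>S n. f s)" "real (card (S n)) * b" "r n"] r[of n]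
      by (simp add: norm_mult m_def mult.assoc)
  qed
  have norm_t: "cmod (t n z) \<le> m n * (1 / b)" if "cmod z \<le> 1 - b" "b > 0" for n z b
    unfolding t_def
  proof (rule sum_bound)
    fix s assume s: "s \<in> S n"
    have "b \<le> cmod (1 + of_real (r n) - cnj s * z)"
      using pole_distance_ge'[OF S1[OF s] _ r, of z n] that by simp
    then show "cmod (1 / (1 + of_real (r n) - cnj s * z)) \<le> 1 / b"
      unfolding norm_divide norm_one using that(2) by (intro frac_le) auto
  qed
  have dpos: "infdist z F > 0" if "z \<in> ball 0 1" for z
  proof -
    have "1 - cmod z \<le> dist z w" if "w \<in> F" for w
      using that F(1) norm_triangle_ineq2[of w z] by (auto simp: dist_norm norm_minus_commute)
    then have "1 - cmod z \<le> infdist z F"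
      using F(2) by (auto simp: infdist_def intro!: cINF_greatest)
    then show ?thesis using that by simp
  qed
  have norm_t': "cmod (t' n z) \<le> m n * (1 / (infdist z F)\<^sup>2)" if z: "z \<in> ball 0 1" for n z
    unfolding t'_def
  proof (rule sum_bound)
    fix s assume s: "s \<in> S n"
    have "infdist z F \<le> dist z s" using s sub by (intro infdist_le) auto
    also have "\<dots> \<le> cmod (1 + of_real (r n) - cnj s * z)"
      using pole_distance_ge[OF S1[OF s] _ r, of z n] z by simp
    finally have "(infdist z F)\<^sup>2 \<le> (cmod (1 + of_real (r n) - cnj s * z))\<^sup>2"
      by (intro power_mono infdist_nonneg)
    then have "1 / (cmod (1 + of_real (r n) - cnj s * z))\<^sup>2 \<le> 1 / (infdist z F)\<^sup>2"
      using dpos[OF z] by (intro frac_le) auto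
    then show "cmod (cnj s / (1 + of_real (r n) - cnj s * z)\<^sup>2) \<le> 1 / (infdist z F)\<^sup>2"
      using S1[OF s] by (simp add: norm_divide norm_power)
  qed
  have Re_t: "Re (t n z) = r n * (\<Sum>s\<in>S n. Re (1 / (1 + of_real (r n) - cnj s * z)))" for n z
    by (simp add: t_def Re_sum)
  have Re_t_nonneg: "Re (t n z) \<ge> 0" if "z \<in> ball 0 1" for n z
    unfolding Re_t using that r[of n]
    by (intro mult_nonneg_nonneg sum_nonneg Re_kernel_nonneg S1) auto
  have Re_t_ge: "Re (t n z) \<ge> 1 / 9" if z: "z \<in> ball 0 1" and d: "infdist z F < r n" for n z
  proof -
    obtain w where w: "w \<in> F" "dist z w < r n"
    proof -
      have "(INF a\<in>F. dist z a) < r n" using d F(2) by (simp add: infdist_def)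
      then show ?thesis using F(2) that by (subst (asm) cINF_less_iff) auto
    qed
    then obtain s where s: "s \<in> S n" "dist s w < r n" using cover[of n] by (force simp: r_def)
    have "dist z s < 2 * r n" using w(2) s(2) dist_triangle[of z s w] by (simp add: dist_commute)
    then have "1 / (9 * r n) \<le> Re (1 / (1 + of_real (r n) - cnj s * z))"
      using z by (intro Re_kernel_ge[OF S1[OF s(1)] _ r]) auto
    also have "\<dots> \<le> (\<Sum>s\<in>S n. Re (1 / (1 + of_real (r n) - cnj s * z)))"
      using z by (intro member_le_sum[OF s(1)] Re_kernel_nonneg S1 r fin) auto
    finally have "r n * (1 / (9 * r n)) \<le> Re (t n z)"
      unfolding Re_t by (rule mult_left_mono[OF _ less_imp_le[OF r]])
    then show ?thesis using r[of n] by simp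
  qed
  obtain \<eta> where \<eta>: "\<eta> > 0" "\<And>w::complex. cmod w < \<eta> \<Longrightarrow> cmod (exp w - 1) < e"
  proof -
    have "isCont exp (0::complex)" by simp
    then show ?thesis using that e unfolding continuous_at_eps_delta by (force simp: dist_norm)
  qed
  obtain N where N: "norm (\<Sum>i. m (i + N)) < \<eta> / 18"
    using suminf_exist_split[of "\<eta> / 18" m] \<eta>(1) summ by (meson divide_pos_pos order_refl zero_less_numeral)
  have summN: "summable (\<lambda>n. m (n + N))" using summ by (rule summable_ignore_initial_segment)
  define M where "M = (\<Sum>n. m (n + N))"
  have M0: "M \<ge> 0" unfolding M_def by (intro suminf_nonneg summN m0)
  obtain g g' where g: "\<And>z. z \<in> ball 0 1 \<Longrightarrow> (\<lambda>n. t (n + N) z) sums g z"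
    "\<And>z. z \<in> ball 0 1 \<Longrightarrow> (\<lambda>n. t' (n + N) z) sums g' z"
    "\<And>z. z \<in> ball 0 1 \<Longrightarrow> (g has_field_derivative g' z) (at z)"
  proof -
    have "\<exists>g g'. \<forall>z\<in>ball 0 1. ((\<lambda>n. t (n + N) z) sums g z) \<and> ((\<lambda>n. t' (n + N) z) sums g' z)
        \<and> (g has_field_derivative g' z) (at z)"
    proof (rule series_and_derivative_comparison_local)
      fix x :: complex assume x: "x \<in> ball 0 1"
      define b where "b = (1 - cmod x) / 2"
      have b: "b > 0" using x by (simp add: b_def)
      have "cmod (t (n + N) y) \<le> m (n + N) * (1 / b)" if "y \<in> ball x b" for y n
      proof (rule norm_t[OF _ b])
        have "cmod y \<le> cmod x + dist x y" using norm_triangle_sub[of y x] by (simp add: dist_norm norm_minus_commute)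
        then show "cmod y \<le> 1 - b" using that by (simp add: b_def field_simps)
      qed
      moreover have "summable (\<lambda>n. m (n + N) * (1 / b))" by (rule summable_mult2[OF summN])
      ultimately show "\<exists>d h. 0 < d \<and> summable h \<and>
          (\<forall>\<^sub>F n in sequentially. \<forall>y\<in>ball x d \<inter> ball 0 1. cmod (t (n + N) y) \<le> h n)"
        using b by (intro exI[of _ b] exI[of _ "\<lambda>n. m (n + N) * (1 / b)"]) (auto intro!: always_eventually)
    qed (use deriv_t in auto)
    then show ?thesis using that by blast
  qed
  define u where "u z = exp (- 18 * g z)" for z
  have deriv_u: "(u has_field_derivative (- 18 * g' z * u z)) (at z)" if "z \<in> ball 0 1" for z
    unfolding u_def by (rule derivative_eq_intros g(3)[OF that] refl)+ simp
  have Re_g: "(\<lambda>n. Re (t (n + N) z)) sums Re (g z)" if "z \<in> ball 0 1" for z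
    by (rule sums_Re[OF g(1)[OF that]])
  have norm_u: "cmod (u z) \<le> 4 ^ N * (infdist z F)\<^sup>2" if z: "z \<in> ball 0 1" for z
  proof -
    define d where "d = infdist z F"
    have d: "d > 0" using dpos[OF z] by (simp add: d_def)
    \<comment> \<open>The number of scales, counted from \<open>N\<close>, that exceed \<open>d\<close>.\<close>
    define K where "K = (LEAST k. r (k + N) \<le> d)"
    obtain k where "(1 / 2) ^ k < d" using real_arch_pow_inv[OF d, of "1/2"] by auto
    moreover have "r (k + N) \<le> (1 / 2) ^ k" unfolding r_def by (rule power_decreasing) auto
    ultimately have "r (k + N) \<le> d" by simp
    then have K: "r (K + N) \<le> d" unfolding K_def by (rule LeastI)
    have less: "d < r (n + N)" if "n < K" for n
      using not_less_Least[of n "\<lambda>k. r (k + N) \<le> d"] that by (auto simp: K_def)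
    have "real K * (1 / 9) = (\<Sum>n<K. 1 / 9)" by simp
    also have "\<dots> \<le> (\<Sum>n<K. Re (t (n + N) z))"
      using less by (intro sum_mono Re_t_ge z) (auto simp: d_def)
    also have "\<dots> \<le> Re (g z)"
      unfolding sums_unique[OF Re_g[OF z]]
      by (intro sum_le_suminf sums_summable[OF Re_g[OF z]]) (auto intro: Re_t_nonneg z)
    \<comment> \<open>The factor \<open>18 = 2 * 9\<close> is chosen so that each such scale gains \<open>exp (- 2) \<le> 1 / 4\<close>, the square of the
        ratio of consecutive scales.\<close>
    finally have "exp (- 18 * Re (g z)) \<le> exp (- 2 * real K)" by simp
    also have "\<dots> \<le> (1 / 4) ^ K" by (rule exp_minus_two_le)
    also have "\<dots> = 4 ^ N * (r (K + N))\<^sup>2"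
    proof -
      have "(r (K + N))\<^sup>2 = (1 / 4) ^ K * (1 / 4) ^ N"
        unfolding r_def power2_eq_square power_mult_distrib[symmetric] power_add[symmetric] by simp
      moreover have "4 ^ N * (1 / 4 :: real) ^ N = 1"
        unfolding power_mult_distrib[symmetric] by simp
      ultimately show ?thesis by simp
    qed
    also have "\<dots> \<le> 4 ^ N * d\<^sup>2" using K r[of "K + N"] by (intro mult_left_mono power_mono) auto
    finally show ?thesis by (simp add: u_def d_def)
  qed
  show ?thesis
  proof (rule that[of u "4 ^ N" "18 * M * 4 ^ N"])
    show "u holomorphic_on ball 0 1"
      unfolding holomorphic_on_open[OF open_ball] using deriv_u by blast
    show "cmod (u z) \<le> 1" if "z \<in> ball 0 1" for z
    proof -
      have "Re (g z) \<ge> 0"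
        unfolding sums_unique[OF Re_g[OF that]]
        by (intro suminf_nonneg sums_summable[OF Re_g[OF that]] Re_t_nonneg that)
      then show ?thesis by (simp add: u_def)
    qed
    show "cmod (u z) \<le> 4 ^ N * (infdist z F)\<^sup>2" if "z \<in> ball 0 1" for z
      by (rule norm_u[OF that])
    show "cmod (deriv u z) \<le> 18 * M * 4 ^ N" if z: "z \<in> ball 0 1" for z
    proof -
      have "cmod (g' z) \<le> (\<Sum>n. m (n + N) * (1 / (infdist z F)\<^sup>2))"
        unfolding sums_unique[OF g(2)[OF z]]
        by (intro norm_suminf_le norm_t' z summable_mult2 summN)
      also have "\<dots> = M * (1 / (infdist z F)\<^sup>2)"
        unfolding M_def by (rule suminf_mult2[OF summN, symmetric])
      finally have g'M: "cmod (g' z) \<le> M * (1 / (infdist z F)\<^sup>2)" .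
      have "cmod (deriv u z) = 18 * cmod (g' z) * cmod (u z)"
        using DERIV_imp_deriv[OF deriv_u[OF z]] by (simp add: norm_mult)
      also have "\<dots> \<le> 18 * (M * (1 / (infdist z F)\<^sup>2)) * (4 ^ N * (infdist z F)\<^sup>2)"
        using g'M norm_u[OF z] M0 by (intro mult_mono) auto
      also have "\<dots> = 18 * M * 4 ^ N" using dpos[OF z] by simp
      finally show ?thesis .
    qed
    have "cmod (g 0) \<le> M"
      unfolding sums_unique[OF g(1)[of 0, simplified]] M_def
      using norm_t[of 0 1] by (intro norm_suminf_le summN) simp
    then have "cmod (- 18 * g 0) < \<eta>" using N by (simp add: M_def norm_mult)
    then show "cmod (u 0 - 1) < e" unfolding u_def by (rule \<eta>(2))
  qed
qed

section \<open>Density of the domain\<close>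

text \<open>Expand the square: \<open>\<parallel>1\<parallel> = 1\<close>, \<open>\<langle>1, u\<rangle> = u 0\<close>, and \<open>\<parallel>u\<parallel> \<le> 1\<close> by the bound on \<open>u\<close>. The constant
  function \<open>1\<close> of the Hardy space is the cut off polynomial \<open>disc_poly (\<lambda>_. 1) 1\<close>.\<close>

lemma hnorm_one_diff_square_le:
  assumes u: "u holomorphic_on ball 0 1" "\<And>z. z \<notin> ball 0 1 \<Longrightarrow> u z = 0"
    "\<And>z. z \<in> ball 0 1 \<Longrightarrow> cmod (u z) \<le> 1"
  shows "(hnorm (disc_poly (\<lambda>_. 1) 1 - u))\<^sup>2 \<le> 2 * cmod (u 0 - 1)"
proof -
  let ?e = "disc_poly (\<lambda>_. 1) 1"
  have u2: "u \<in> hardy2" by (rule bounded_holomorphic_hardy2[OF u])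
  have e2: "?e \<in> hardy2" by (rule disc_poly_hardy2)
  have e: "taylor_coeff ?e k = (if k = 0 then 1 else 0)" for k by (simp add: taylor_coeff_disc_poly)
  have "(hnorm ?e)\<^sup>2 = (\<Sum>k\<in>{0}. (cmod (taylor_coeff ?e k))\<^sup>2)"
    unfolding hnorm_square[OF e2] by (rule suminf_finite) (auto simp: e simp del: One_nat_def)
  then have ne: "(hnorm ?e)\<^sup>2 = 1" by (simp add: e del: One_nat_def)
  have "hinner ?e u = (\<Sum>k\<in>{0}. cnj (taylor_coeff ?e k) * taylor_coeff u k)"
    unfolding hinner_def by (rule suminf_finite) (auto simp: e simp del: One_nat_def)
  then have "hinner ?e u = u 0" by (simp add: e taylor_coeff_def[of u] del: One_nat_def)
  then have "(hnorm (?e - u))\<^sup>2 = 1 - 2 * Re (u 0) + (hnorm u)\<^sup>2"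
    using hnorm_diff_square[OF e2 u2] unfolding ne by (simp only:)
  also have "\<dots> \<le> 2 * (1 - Re (u 0))"
    using bounded_holomorphic_hnorm[OF u] by simp
  also have "\<dots> \<le> 2 * cmod (u 0 - 1)"
    using complex_Re_le_cmod[of "1 - u 0"] by (simp add: norm_minus_commute)
  finally show ?thesis .
qed

lemma polynomial_mult_dom_L_op:
  assumes u: "u holomorphic_on ball 0 1" "\<And>z. z \<notin> ball 0 1 \<Longrightarrow> u z = 0"
    and bd: "\<And>z. z \<in> ball 0 1 \<Longrightarrow> cmod (u z) \<le> 1"
    and bd': "\<And>z. z \<in> ball 0 1 \<Longrightarrow> cmod (deriv u z) \<le> B"
    and van: "\<And>z. z \<in> ball 0 1 \<Longrightarrow> cmod (u z) \<le> A * (infdist z F)\<^sup>2"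
    and F: "F \<subseteq> cball 0 1"
  shows "(\<lambda>z. (\<Sum>k<n. a k * z ^ k) * u z) \<in> dom_op (L_op F)"
proof -
  define p where "p = (\<lambda>z. \<Sum>k<n. a k * z ^ k)"
  have hol: "p holomorphic_on UNIV" unfolding p_def by (intro holomorphic_intros)
  have hol': "deriv p holomorphic_on UNIV" by (rule holomorphic_deriv[OF hol]) simp
  have bounded: "\<exists>W>0. \<forall>z\<in>ball 0 1. cmod (q z) \<le> W" if "q holomorphic_on UNIV" for q
  proof -
    have "compact (q ` cball 0 1)"
      using holomorphic_on_imp_continuous_on[OF that]
      by (intro compact_continuous_image) (auto intro: continuous_on_subset)
    then have "bounded (q ` cball 0 1)" by (rule compact_imp_bounded)
    then obtain W where "W > 0" "\<And>x. x \<in> q ` cball 0 1 \<Longrightarrow> norm x \<le> W"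
      unfolding bounded_pos by blast
    then show ?thesis by (intro exI[of _ W]) auto
  qed
  obtain W where W: "W > 0" "\<And>z. z \<in> ball 0 1 \<Longrightarrow> cmod (p z) \<le> W" using bounded[OF hol] by blast
  obtain W' where W': "W' > 0" "\<And>z. z \<in> ball 0 1 \<Longrightarrow> cmod (deriv p z) \<le> W'"
    using bounded[OF hol'] by blast
  have "(\<lambda>z. p z * u z) \<in> dom_op (L_op F)"
  proof (rule dom_L_opI[where B = W and B' = "W * B + W'" and C = "W * A"])
    show "(\<lambda>z. p z * u z) holomorphic_on ball 0 1"
      by (intro holomorphic_intros u(1) holomorphic_on_subset[OF hol]) auto
    show "p z * u z = 0" if "z \<notin> ball 0 1" for z using u(2)[OF that] by simp
    fix z :: complex assume z: "z \<in> ball 0 1"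
    show "cmod (p z * u z) \<le> W"
      using mult_mono[OF W(2)[OF z] bd[OF z]] W(1) by (simp add: norm_mult)
    have "(p has_field_derivative deriv p z) (at z)"
      by (rule holomorphic_derivI[OF hol]) auto
    moreover have "(u has_field_derivative deriv u z) (at z)"
      by (rule holomorphic_derivI[OF u(1) _ z]) simp
    ultimately have "((\<lambda>z. p z * u z) has_field_derivative (p z * deriv u z + deriv p z * u z)) (at z)"
      by (rule DERIV_mult')
    then have "deriv (\<lambda>z. p z * u z) z = p z * deriv u z + deriv p z * u z"
      by (rule DERIV_imp_deriv)
    also have "cmod \<dots> \<le> cmod (p z) * cmod (deriv u z) + cmod (deriv p z) * cmod (u z)"
      using norm_triangle_ineq[of "p z * deriv u z" "deriv p z * u z"] by (simp add: norm_mult)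
    also have "\<dots> \<le> W * B + W' * 1"
      using W(1) W'(1) by (intro add_mono mult_mono W(2) W'(2) bd bd' z) auto
    finally show "cmod (deriv (\<lambda>z. p z * u z) z) \<le> W * B + W'" by simp
    have "cmod (p z) * cmod (u z) \<le> W * (A * (infdist z F)\<^sup>2)"
      using W(1) by (intro mult_mono W(2) van z) auto
    then show "cmod (p z * u z) \<le> W * A * (infdist z F)\<^sup>2" by (simp add: norm_mult mult.assoc)
  qed (rule F)
  then show ?thesis by (simp add: p_def)
qed

text \<open>A Taylor polynomial \<open>p\<close> of \<open>f\<close> approximates \<open>f\<close>, and \<open>p u\<close> approximates \<open>p\<close> when \<open>u\<close> is a function from
  \<open>exists_vanishing_function\<close> that is close to \<open>1\<close>.\<close>

lemma densely_defined_L_op: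
  assumes F: "F \<subseteq> sphere 0 1" "closed F" "F \<noteq> {}" and null: "emeasure circle_haar F = 0"
    and carl: "carleson_condition F"
  shows "densely_defined (L_op F)"
proof -
  define S where "S n = (SOME S. finite S \<and> S \<subseteq> F \<and> F \<subseteq> (\<Union>s\<in>S. ball s ((1 / 2) ^ n)) \<and>
    (1 / 2) ^ n * real (card S) \<le> 4 * pi * measure circle_haar {z. infdist z F < (1 / 2) ^ n})" for n :: nat
  have S: "finite (S n) \<and> S n \<subseteq> F \<and> F \<subseteq> (\<Union>s\<in>S n. ball s ((1 / 2) ^ n)) \<and>
    (1 / 2) ^ n * real (card (S n)) \<le> 4 * pi * measure circle_haar {z. infdist z F < (1 / 2) ^ n}" for n
    unfolding S_def
  proof (rule someI_ex)
    have "0 < (1 / 2 :: real) ^ n" "(1 / 2 :: real) ^ n \<le> 1" by (auto intro: power_le_one)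
    from separated_net[OF F(1) this]
    show "\<exists>S. finite S \<and> S \<subseteq> F \<and> F \<subseteq> (\<Union>s\<in>S. ball s ((1 / 2) ^ n)) \<and>
      (1 / 2) ^ n * real (card S) \<le> 4 * pi * measure circle_haar {z. infdist z F < (1 / 2) ^ n}"
      by metis
  qed
  have summ: "summable (\<lambda>n. (1 / 2) ^ n * real (card (S n)))"
  proof (rule summable_comparison_test'[where N = 0])
    show "summable (\<lambda>n. 4 * pi * measure circle_haar {z. infdist z F < (1 / 2) ^ n})"
      by (intro summable_mult carleson_summable F null carl)
    show "norm ((1 / 2) ^ n * real (card (S n)))
        \<le> 4 * pi * measure circle_haar {z. infdist z F < (1 / 2) ^ n}" for n
      using S[of n] by simp
  qed
  have Fc: "F \<subseteq> cball 0 1" using F by auto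
  have "\<exists>g\<in>dom_op (L_op F). hnorm (f - g) < e" if f: "f \<in> hardy2" and e: "e > 0" for f e
  proof -
    define a where "a = taylor_coeff f"
    obtain n where n: "hnorm (f - disc_poly a n) < e / 2"
      using polynomials_dense[OF f, of "e / 2"] e unfolding a_def by auto
    define W where "W = (\<Sum>k<n. cmod (a k))"
    have W: "W \<ge> 0" unfolding W_def by (intro sum_nonneg) auto
    define \<delta> where "\<delta> = e / (2 * (W + 1))"
    have \<delta>: "\<delta> > 0" using e W by (simp add: \<delta>_def)
    obtain u A B where u: "u holomorphic_on ball 0 1"
      "\<And>z. z \<in> ball 0 1 \<Longrightarrow> cmod (u z) \<le> 1"
      "\<And>z. z \<in> ball 0 1 \<Longrightarrow> cmod (u z) \<le> A * (infdist z F)\<^sup>2"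
      "\<And>z. z \<in> ball 0 1 \<Longrightarrow> cmod (deriv u z) \<le> B"
      "cmod (u 0 - 1) < \<delta>\<^sup>2 / 2"
      using exists_vanishing_function[OF F(1,3) _ _ _ summ, of "\<delta>\<^sup>2 / 2"] S \<delta> by (metis half_gt_zero zero_less_power)
    \<comment> \<open>The values of \<open>u\<close> off the disc are arbitrary, those of an element of \<open>hardy2\<close> are \<open>0\<close>.\<close>
    define v where "v = (\<lambda>z. if z \<in> ball 0 1 then u z else 0)"
    have v: "v holomorphic_on ball 0 1"
      by (rule holomorphic_transform[OF u(1)]) (simp add: v_def)
    have v0: "v z = 0" if "z \<notin> ball 0 1" for z using that by (simp add: v_def)
    have v1: "cmod (v z) \<le> 1" if "z \<in> ball 0 1" for z using u(2)[OF that] that by (simp add: v_def)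
    have dv: "deriv v z = deriv u z" if "z \<in> ball 0 1" for z
    proof (rule deriv_cong_ev[OF _ refl])
      show "\<forall>\<^sub>F w in nhds z. v w = u w"
        using eventually_nhds_in_open[OF open_ball that] by eventually_elim (simp add: v_def)
    qed
    let ?g = "\<lambda>z. (\<Sum>k<n. a k * z ^ k) * v z" and ?w = "disc_poly (\<lambda>_. 1) 1 - v"
    have g: "?g \<in> dom_op (L_op F)"
    proof (rule polynomial_mult_dom_L_op[OF v v0 v1 _ _ Fc])
      fix z :: complex assume z: "z \<in> ball 0 1"
      show "cmod (deriv v z) \<le> B" unfolding dv[OF z] by (rule u(4)[OF z])
      show "cmod (v z) \<le> A * (infdist z F)\<^sup>2" using u(3)[OF z] z by (simp add: v_def)
    qed
    have w: "?w \<in> hardy2"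
      by (intro hardy2_diff disc_poly_hardy2 bounded_holomorphic_hardy2[OF v v0 v1])
    have "(hnorm ?w)\<^sup>2 \<le> 2 * cmod (v 0 - 1)"
      by (rule hnorm_one_diff_square_le[OF v v0 v1])
    also have "\<dots> \<le> \<delta>\<^sup>2" using u(5) by (simp add: v_def)
    finally have w\<delta>: "hnorm ?w \<le> \<delta>" 
      by (rule power2_le_imp_le[OF _ less_imp_le[OF \<delta>]])
    \<comment> \<open>\<open>f - p v = (f - p) + p (1 - v)\<close>, read on the whole plane with all functions cut off.\<close>
    have split: "f - ?g = (f - disc_poly a n) + (\<lambda>z. (\<Sum>k<n. a k * z ^ k) * ?w z)"
    proof
      fix z
      show "(f - ?g) z = ((f - disc_poly a n) + (\<lambda>z. (\<Sum>k<n. a k * z ^ k) * ?w z)) z"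
      proof (cases "z \<in> ball 0 1")
        case True
        then show ?thesis
          unfolding minus_apply plus_fun_apply disc_poly_eq[OF True]
          by (simp add: right_diff_distrib)
      next
        case False
        then show ?thesis
          unfolding minus_apply plus_fun_apply disc_poly_outside[OF False] v0[OF False] by simp
      qed
    qed
    have "hnorm (f - ?g) \<le> hnorm (f - disc_poly a n) + hnorm (\<lambda>z. (\<Sum>k<n. a k * z ^ k) * ?w z)"
      unfolding split using hnorm_polynomial_mult[OF w]
      by (intro hnorm_triangle hardy2_diff f disc_poly_hardy2) blast
    also have "\<dots> < e / 2 + W * \<delta>"
    proof (rule add_less_le_mono[OF n])
      have "hnorm (\<lambda>z. (\<Sum>k<n. a k * z ^ k) * ?w z) \<le> W * hnorm ?w"
        unfolding W_def using hnorm_polynomial_mult[OF w] by blast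
      also have "\<dots> \<le> W * \<delta>" using w\<delta> W by (rule mult_left_mono)
      finally show "hnorm (\<lambda>z. (\<Sum>k<n. a k * z ^ k) * ?w z) \<le> W * \<delta>" .
    qed
    also have "\<dots> \<le> e"
    proof -
      have "W * \<delta> \<le> (W + 1) * \<delta>" using \<delta> by simp
      also have "\<dots> = e / 2"
        unfolding \<delta>_def using W by (simp add: divide_simps)
      finally show ?thesis by simp
    qed
    finally show ?thesis using g by blast
  qed
  moreover have "dom_op (L_op F) \<subseteq> hardy2" by (auto simp: dom_L_op dom_H_op)
  ultimately show ?thesis by (simp add: densely_defined_def)
qed

theorem corollary6p14:
  fixes F :: "complex set"
  assumes "F \<subseteq> sphere 0 1" and "closed F" and "emeasure circle_haar F = 0"
    and "infinite F" and "carleson_condition F"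
  shows "hermitian_op (L_op F) \<and> densely_defined (L_op F) \<and>
         deficiency_indices (L_op F) = (\<infinity>, \<infinity>)"
proof -
  have "F \<noteq> {}" using assms(4) by auto
  then have dense: "densely_defined (L_op F)"
    by (rule densely_defined_L_op[OF assms(1,2) _ assms(3,5)])
  have "deficiency_indices (L_op F) = (\<infinity>, \<infinity>)"
    unfolding deficiency_indices_def
    using cdim_deficiency[OF _ _ assms(1,4) dense] by simp
  then show ?thesis using hermitian_L_op dense by simp
qed

end
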